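(* Let $(M,\varphi,\xi,\eta,g)$ be a 3-dimensional Sasaki-like almost contact B-metric manifold and $C(t)$ a Legendre null curve in $M$, with $b=g(\dot C,\varphi\dot C)$. Let $\epsilon=\pm1$, $\epsilon_1=\pm1$. (i) If the screen vector bundle of $C(t)$ is $S(TC^\perp)=\mathrm{span}\{W=\epsilon\xi\}$, then in the Frenet frame $\{\dot C,N,W\}$ $$N=\frac1b\varphi\dot C,\qquad h=\frac{\dot b}{2b},\qquad k_2=0.$$ (ii) If the screen vector bundle of $C(t)$ is $\bar S(TC^\perp)=\mathrm{span}\{\overline W\}$, where $\overline W=\epsilon_1\left(\epsilon\xi+\epsilon\frac{\dot b}{2b^2}\dot C\right)$, then the original parameter $t$ of $C(t)$ is distinguished, and in the Frenet frame $\{\dot C,\overline N,\overline W\}$ $$\overline N=-\frac{\dot b}{2b^2}\xi-\frac{\dot b^2}{8b^4}\dot C+\frac1b\varphi\dot C,\qquad \bar k_2=\epsilon_1\left(\frac{4b\ddot b-7\dot b^2}{8b^3}\right).$$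
   Context: A 3-dimensional almost contact B-metric manifold $(M,\varphi,\xi,\eta,g)$ is a smooth 3-manifold with an endomorphism $\varphi$ of $TM$, a vector field $\xi$, a 1-form $\eta$ and a pseudo-Riemannian metric $g$ (necessarily of signature $(+,+,-)$) such that $\varphi^2X=-X+\eta(X)\xi$, $\eta(\xi)=1$, $g(\varphi X,\varphi Y)=-g(X,Y)+\eta(X)\eta(Y)$. Consequences: $\eta\circ\varphi=0$, $\varphi\xi=0$, $\eta(X)=g(X,\xi)$. With $\nabla$ the Levi-Civita connection of $g$, it is Sasaki-like if $(\nabla_X\varphi)Y=-g(X,Y)\xi-\eta(Y)X+2\eta(X)\eta(Y)\xi$ (then $\nabla_X\xi=-\varphi X$). A smooth curve $C:I\to M$ ($I$ an interval) is null if $g(\dot C,\dot C)=0$ and $\dot C\neq 0$ on $I$; it is Legendre if $\eta(\dot C)=0$. Dots on $b$ denote derivatives in $t$; for a Legendre null curve $b$ is nowhere zero. A general Frenet frame along a null curve $C$ is $\{\dot C,N,W\}$ with $g(\dot C,N)=g(W,W)=1$, $g(N,N)=g(N,W)=g(\dot C,W)=0$; for given $W$ (spanning the screen vector bundle) the field $N$ is unique. The Frenet equations are $\nabla_{\dot C}\dot C=h\dot C+k_1W$, $\nabla_{\dot C}N=-hN+k_2W$, $\nabla_{\dot C}W=-k_2\dot C-k_1N$, defining the functions $h,k_1,k_2$ for this frame; for $\{\dot C,\overline N,\overline W\}$ they are written $\bar h,\bar k_1,\bar k_2$. The parameter is distinguished (for a given frame) if the corresponding $h$ vanishes. For the two frames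 of the claim, $k_1=\epsilon b$ and $\bar k_1=\epsilon_1\epsilon b$.
   Formalization: In (ii) the formula for k̄₂ is corrected to k̄₂ = −εε₁(4bb̈ − 7ḃ²)/(8b³); the printed ε₁(4bb̈ − 7ḃ²)/(8b³) agrees with it for ε = −1 but has the wrong sign for ε = +1. *)

theory Defs
  imports "HOL-Analysis.Analysis" "HOL-Library.Function_Algebras"
begin

section \<open>Smoothness\<close>

text \<open>
  The definitions are applied only to open sets and to relatively open subsets of non-degenerate
  intervals (on which derivatives at end points are one-sided); there the derivative within
  the set is unique.
\<close>

primrec C_on :: "nat \<Rightarrow> 'a::real_normed_vector set \<Rightarrow> ('a \<Rightarrow> 'b::real_normed_vector) \<Rightarrow> bool" where
  "C_on 0 S f \<longleftrightarrow> continuous_on S f"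
| "C_on (Suc k) S f \<longleftrightarrow>
     (\<forall>x\<in>S. f differentiable (at x within S)) \<and>
     (\<forall>v. C_on k S (\<lambda>x. frechet_derivative f (at x within S) v))"

definition smooth_on :: "'a::real_normed_vector set \<Rightarrow> ('a \<Rightarrow> 'b::real_normed_vector) \<Rightarrow> bool" where
  "smooth_on S f \<longleftrightarrow> (\<forall>k. C_on k S f)"


section \<open>Smooth 3-manifolds\<close>

text \<open>A chart is a pair of its domain and its coordinate map.\<close>

type_synonym 'm chart = "'m set \<times> ('m \<Rightarrow> real^3)"

abbreviation dom_chart :: "'m chart \<Rightarrow> 'm set" where
  "dom_chart c \<equiv> fst c"

abbreviation coords :: "'m chart \<Rightarrow> 'm \<Rightarrow> real^3" where
  "coords c \<equiv> snd c"

definition chart_inv :: "'m chart \<Rightarrow> real^3 \<Rightarrow> 'm" where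
  "chart_inv c = inv_into (dom_chart c) (coords c)"

definition transition :: "'m chart \<Rightarrow> 'm chart \<Rightarrow> real^3 \<Rightarrow> real^3" where
  "transition c d = coords d \<circ> chart_inv c"

definition is_chart :: "'m topology \<Rightarrow> 'm chart \<Rightarrow> bool" where
  "is_chart T c \<longleftrightarrow> openin T (dom_chart c) \<and> open (coords c ` dom_chart c) \<and>
     homeomorphic_map (subtopology T (dom_chart c)) (top_of_set (coords c ` dom_chart c)) (coords c)"

text \<open>The atlas need not be maximal; all notions below depend only on the smooth structure it
  generates.\<close>

definition smooth_3_manifold :: "'m topology \<Rightarrow> 'm chart set \<Rightarrow> bool" where
  "smooth_3_manifold T A \<longleftrightarrow> Hausdorff_space T \<and> second_countable T \<and>
     (\<forall>c\<in>A. is_chart T c) \<and> (\<Union>c\<in>A. dom_chart c) = topspace T \<and>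
     (\<forall>c\<in>A. \<forall>d\<in>A. smooth_on (coords c ` (dom_chart c \<inter> dom_chart d)) (transition c d))"

definition charts_at :: "'m chart set \<Rightarrow> 'm \<Rightarrow> 'm chart set" where
  "charts_at A p = {c \<in> A. p \<in> dom_chart c}"

definition some_chart :: "'m chart set \<Rightarrow> 'm \<Rightarrow> 'm chart" where
  "some_chart A p = (SOME c. c \<in> charts_at A p)"

definition smooth_function :: "'m chart set \<Rightarrow> 'm set \<Rightarrow> ('m \<Rightarrow> real) \<Rightarrow> bool" where
  "smooth_function A U f \<longleftrightarrow> (\<forall>c\<in>A. smooth_on (coords c ` (U \<inter> dom_chart c)) (f \<circ> chart_inv c))"


section \<open>Tangent vectors and vector fields\<close>

instantiation "fun" :: (type, real_vector) real_vector
begin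

definition scaleR_fun_def: "a *\<^sub>R f = (\<lambda>x. a *\<^sub>R f x)"

instance
  by standard (simp_all add: scaleR_fun_def fun_eq_iff scaleR_add_right scaleR_add_left)

end

text \<open>
  A tangent vector at \<open>p\<close> is the family of its component vectors in all the charts around \<open>p\<close>, related
  by the Jacobians of the transition maps; the values at the other charts are set to 0, so that
  equality of tangent vectors is equality of functions.  The vector space operations are pointwise.
\<close>

type_synonym 'm tvec = "'m chart \<Rightarrow> real^3"

definition tangent_space :: "'m chart set \<Rightarrow> 'm \<Rightarrow> 'm tvec set" where
  "tangent_space A p = {v.
     (\<forall>c\<in>charts_at A p. \<forall>d\<in>charts_at A p.
        v d = frechet_derivative (transition c d) (at (coords c p)) (v c)) \<and>
     (\<forall>c. c \<notin> charts_at A p \<longrightarrow> v c = 0)}"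

definition vector_field :: "'m chart set \<Rightarrow> 'm set \<Rightarrow> ('m \<Rightarrow> 'm tvec) \<Rightarrow> bool" where
  "vector_field A U X \<longleftrightarrow> (\<forall>p\<in>U. X p \<in> tangent_space A p) \<and>
     (\<forall>c\<in>A. smooth_on (coords c ` (U \<inter> dom_chart c)) (\<lambda>x. X (chart_inv c x) c))"

text \<open>The coordinate vector field \<open>\<partial>/\<partial>x\<^sub>j\<close> of the chart \<open>c\<close>, a vector field on the domain of \<open>c\<close>.\<close>

definition coord_field :: "'m chart set \<Rightarrow> 'm chart \<Rightarrow> 3 \<Rightarrow> 'm \<Rightarrow> 'm tvec" where
  "coord_field A c j p = (\<lambda>d. if d \<in> charts_at A p
     then frechet_derivative (transition c d) (at (coords c p)) (axis j 1) else 0)"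

definition dir_deriv :: "'m chart set \<Rightarrow> 'm \<Rightarrow> 'm tvec \<Rightarrow> ('m \<Rightarrow> real) \<Rightarrow> real" where
  "dir_deriv A p v f = (let c = some_chart A p in
     frechet_derivative (f \<circ> chart_inv c) (at (coords c p)) (v c))"

definition lie_bracket ::
  "'m chart set \<Rightarrow> ('m \<Rightarrow> 'm tvec) \<Rightarrow> ('m \<Rightarrow> 'm tvec) \<Rightarrow> 'm \<Rightarrow> 'm tvec" where
  "lie_bracket A X Y p = (\<lambda>c. if c \<in> charts_at A p
     then frechet_derivative (\<lambda>x. Y (chart_inv c x) c) (at (coords c p)) (X p c) -
          frechet_derivative (\<lambda>x. X (chart_inv c x) c) (at (coords c p)) (Y p c)
     else 0)"


section \<open>Tensor fields\<close>

definition one_form ::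
  "'m topology \<Rightarrow> 'm chart set \<Rightarrow> ('m \<Rightarrow> 'm tvec \<Rightarrow> real) \<Rightarrow> bool" where
  "one_form T A \<eta> \<longleftrightarrow>
     (\<forall>p\<in>topspace T. \<forall>v\<in>tangent_space A p. \<forall>w\<in>tangent_space A p. \<forall>a b.
        \<eta> p (a *\<^sub>R v + b *\<^sub>R w) = a * \<eta> p v + b * \<eta> p w) \<and>
     (\<forall>U X. openin T U \<longrightarrow> vector_field A U X \<longrightarrow> smooth_function A U (\<lambda>p. \<eta> p (X p)))"

definition endomorphism_field ::
  "'m topology \<Rightarrow> 'm chart set \<Rightarrow> ('m \<Rightarrow> 'm tvec \<Rightarrow> 'm tvec) \<Rightarrow> bool" where
  "endomorphism_field T A \<phi> \<longleftrightarrow>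
     (\<forall>p\<in>topspace T. \<forall>v\<in>tangent_space A p. \<phi> p v \<in> tangent_space A p) \<and>
     (\<forall>p\<in>topspace T. \<forall>v\<in>tangent_space A p. \<forall>w\<in>tangent_space A p. \<forall>a b.
        \<phi> p (a *\<^sub>R v + b *\<^sub>R w) = a *\<^sub>R \<phi> p v + b *\<^sub>R \<phi> p w) \<and>
     (\<forall>U X. openin T U \<longrightarrow> vector_field A U X \<longrightarrow> vector_field A U (\<lambda>p. \<phi> p (X p)))"

definition pseudo_riemannian_metric ::
  "'m topology \<Rightarrow> 'm chart set \<Rightarrow> ('m \<Rightarrow> 'm tvec \<Rightarrow> 'm tvec \<Rightarrow> real) \<Rightarrow> bool" where
  "pseudo_riemannian_metric T A g \<longleftrightarrow>
     (\<forall>p\<in>topspace T. \<forall>u\<in>tangent_space A p. \<forall>v\<in>tangent_space A p. \<forall>w\<in>tangent_space A p. \<forall>a b.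
        g p (a *\<^sub>R u + b *\<^sub>R v) w = a * g p u w + b * g p v w) \<and>
     (\<forall>p\<in>topspace T. \<forall>v\<in>tangent_space A p. \<forall>w\<in>tangent_space A p. g p v w = g p w v) \<and>
     (\<forall>p\<in>topspace T. \<forall>v\<in>tangent_space A p. (\<forall>w\<in>tangent_space A p. g p v w = 0) \<longrightarrow> v = 0) \<and>
     (\<forall>U X Y. openin T U \<longrightarrow> vector_field A U X \<longrightarrow> vector_field A U Y \<longrightarrow>
        smooth_function A U (\<lambda>p. g p (X p) (Y p)))"


section \<open>The Levi-Civita connection\<close>

text \<open>
  \<open>D p v Y\<close> is the covariant derivative at \<open>p\<close> of \<open>Y\<close> in the direction \<open>v\<close>.  A connection acts on vector
  fields defined on arbitrary open sets; the last clause says that \<open>D p v Y\<close> depends only on the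
  germ of \<open>Y\<close> at \<open>p\<close>.
\<close>

type_synonym 'm connection = "'m \<Rightarrow> 'm tvec \<Rightarrow> ('m \<Rightarrow> 'm tvec) \<Rightarrow> 'm tvec"

definition affine_connection :: "'m topology \<Rightarrow> 'm chart set \<Rightarrow> 'm connection \<Rightarrow> bool" where
  "affine_connection T A D \<longleftrightarrow> (\<forall>U. openin T U \<longrightarrow>
     (\<forall>X Y. vector_field A U X \<longrightarrow> vector_field A U Y \<longrightarrow>
        vector_field A U (\<lambda>p. D p (X p) Y)) \<and>
     (\<forall>p\<in>U. \<forall>v\<in>tangent_space A p.
        (\<forall>Y. vector_field A U Y \<longrightarrow> D p v Y \<in> tangent_space A p) \<and>
        (\<forall>Y. vector_field A U Y \<longrightarrow> (\<forall>w\<in>tangent_space A p. \<forall>a b.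
           D p (a *\<^sub>R v + b *\<^sub>R w) Y = a *\<^sub>R D p v Y + b *\<^sub>R D p w Y)) \<and>
        (\<forall>Y Z. vector_field A U Y \<longrightarrow> vector_field A U Z \<longrightarrow>
           D p v (\<lambda>q. Y q + Z q) = D p v Y + D p v Z) \<and>
        (\<forall>f Y. smooth_function A U f \<longrightarrow> vector_field A U Y \<longrightarrow>
           D p v (\<lambda>q. f q *\<^sub>R Y q) = dir_deriv A p v f *\<^sub>R Y p + f p *\<^sub>R D p v Y) \<and>
        (\<forall>Y Z. vector_field A U Y \<longrightarrow> vector_field A U Z \<longrightarrow> (\<forall>q\<in>U. Y q = Z q) \<longrightarrow>
           D p v Y = D p v Z)))"

definition torsion_free :: "'m topology \<Rightarrow> 'm chart set \<Rightarrow> 'm connection \<Rightarrow> bool" where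
  "torsion_free T A D \<longleftrightarrow> (\<forall>U X Y. openin T U \<longrightarrow> vector_field A U X \<longrightarrow> vector_field A U Y \<longrightarrow>
     (\<forall>p\<in>U. D p (X p) Y - D p (Y p) X = lie_bracket A X Y p))"

definition metric_connection ::
  "'m topology \<Rightarrow> 'm chart set \<Rightarrow> ('m \<Rightarrow> 'm tvec \<Rightarrow> 'm tvec \<Rightarrow> real) \<Rightarrow> 'm connection \<Rightarrow> bool" where
  "metric_connection T A g D \<longleftrightarrow>
     (\<forall>U Y Z. openin T U \<longrightarrow> vector_field A U Y \<longrightarrow> vector_field A U Z \<longrightarrow>
        (\<forall>p\<in>U. \<forall>v\<in>tangent_space A p.
           dir_deriv A p v (\<lambda>q. g q (Y q) (Z q)) = g p (D p v Y) (Z p) + g p (Y p) (D p v Z)))"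

definition levi_civita_connection ::
  "'m topology \<Rightarrow> 'm chart set \<Rightarrow> ('m \<Rightarrow> 'm tvec \<Rightarrow> 'm tvec \<Rightarrow> real) \<Rightarrow> 'm connection \<Rightarrow> bool" where
  "levi_civita_connection T A g D \<longleftrightarrow>
     affine_connection T A D \<and> torsion_free T A D \<and> metric_connection T A g D"


section \<open>Almost contact B-metric manifolds\<close>

definition almost_contact_B_metric_3_manifold ::
  "'m topology \<Rightarrow> 'm chart set \<Rightarrow> ('m \<Rightarrow> 'm tvec \<Rightarrow> 'm tvec) \<Rightarrow> ('m \<Rightarrow> 'm tvec) \<Rightarrow>
   ('m \<Rightarrow> 'm tvec \<Rightarrow> real) \<Rightarrow> ('m \<Rightarrow> 'm tvec \<Rightarrow> 'm tvec \<Rightarrow> real) \<Rightarrow> bool" where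
  "almost_contact_B_metric_3_manifold T A \<phi> \<xi> \<eta> g \<longleftrightarrow>
     smooth_3_manifold T A \<and> endomorphism_field T A \<phi> \<and> vector_field A (topspace T) \<xi> \<and>
     one_form T A \<eta> \<and> pseudo_riemannian_metric T A g \<and>
     (\<forall>p\<in>topspace T. \<eta> p (\<xi> p) = 1 \<and>
        (\<forall>X\<in>tangent_space A p. \<phi> p (\<phi> p X) = - X + \<eta> p X *\<^sub>R \<xi> p) \<and>
        (\<forall>X\<in>tangent_space A p. \<forall>Y\<in>tangent_space A p.
           g p (\<phi> p X) (\<phi> p Y) = - g p X Y + \<eta> p X * \<eta> p Y))"

text \<open>The left-hand side is \<open>(\<nabla>\<^sub>X \<phi>) Y = \<nabla>\<^sub>X (\<phi> Y) - \<phi> (\<nabla>\<^sub>X Y)\<close>.\<close>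

definition sasaki_like ::
  "'m topology \<Rightarrow> 'm chart set \<Rightarrow> ('m \<Rightarrow> 'm tvec \<Rightarrow> 'm tvec) \<Rightarrow> ('m \<Rightarrow> 'm tvec) \<Rightarrow>
   ('m \<Rightarrow> 'm tvec \<Rightarrow> real) \<Rightarrow> ('m \<Rightarrow> 'm tvec \<Rightarrow> 'm tvec \<Rightarrow> real) \<Rightarrow> 'm connection \<Rightarrow> bool" where
  "sasaki_like T A \<phi> \<xi> \<eta> g D \<longleftrightarrow>
     (\<forall>U Y. openin T U \<longrightarrow> vector_field A U Y \<longrightarrow> (\<forall>p\<in>U. \<forall>X\<in>tangent_space A p.
        D p X (\<lambda>q. \<phi> q (Y q)) - \<phi> p (D p X Y) =
          - g p X (Y p) *\<^sub>R \<xi> p - \<eta> p (Y p) *\<^sub>R X + (2 * \<eta> p X * \<eta> p (Y p)) *\<^sub>R \<xi> p))"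


section \<open>Curves and covariant differentiation along curves\<close>

definition smooth_curve ::
  "'m topology \<Rightarrow> 'm chart set \<Rightarrow> real set \<Rightarrow> (real \<Rightarrow> 'm) \<Rightarrow> bool" where
  "smooth_curve T A I C \<longleftrightarrow> is_interval I \<and> interior I \<noteq> {} \<and> continuous_map (top_of_set I) T C \<and>
     (\<forall>c\<in>A. smooth_on {t \<in> I. C t \<in> dom_chart c} (coords c \<circ> C))"

definition velocity :: "'m chart set \<Rightarrow> real set \<Rightarrow> (real \<Rightarrow> 'm) \<Rightarrow> real \<Rightarrow> 'm tvec" where
  "velocity A I C t = (\<lambda>c. if c \<in> charts_at A (C t)
     then vector_derivative (coords c \<circ> C) (at t within I) else 0)"

definition field_along ::
  "'m chart set \<Rightarrow> real set \<Rightarrow> (real \<Rightarrow> 'm) \<Rightarrow> (real \<Rightarrow> 'm tvec) \<Rightarrow> bool" where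
  "field_along A I C V \<longleftrightarrow> (\<forall>t\<in>I. V t \<in> tangent_space A (C t)) \<and>
     (\<forall>c\<in>A. smooth_on {t \<in> I. C t \<in> dom_chart c} (\<lambda>t. V t c))"

text \<open>
  If \<open>V = \<Sum>\<^sub>j V\<^sub>j \<partial>\<^sub>j\<close> along \<open>C\<close>, then its covariant derivative in the direction of the velocity \<open>C'\<close> is
  \<open>\<Sum>\<^sub>j (V\<^sub>j' \<partial>\<^sub>j + V\<^sub>j \<nabla>\<^bsub>C'\<^esub> \<partial>\<^sub>j)\<close>; the value does not depend on the chart around \<open>C t\<close>.
\<close>

definition cov_deriv_along ::
  "'m chart set \<Rightarrow> 'm connection \<Rightarrow> real set \<Rightarrow> (real \<Rightarrow> 'm) \<Rightarrow> (real \<Rightarrow> 'm tvec) \<Rightarrow> real \<Rightarrow> 'm tvec" where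
  "cov_deriv_along A D I C V t = (let c = some_chart A (C t) in
     \<Sum>j\<in>UNIV. vector_derivative (\<lambda>s. V s c $ j) (at t within I) *\<^sub>R coord_field A c j (C t)
       + (V t c $ j) *\<^sub>R D (C t) (velocity A I C t) (coord_field A c j))"

definition null_curve ::
  "'m topology \<Rightarrow> 'm chart set \<Rightarrow> ('m \<Rightarrow> 'm tvec \<Rightarrow> 'm tvec \<Rightarrow> real) \<Rightarrow> real set \<Rightarrow> (real \<Rightarrow> 'm) \<Rightarrow> bool" where
  "null_curve T A g I C \<longleftrightarrow> smooth_curve T A I C \<and>
     (\<forall>t\<in>I. g (C t) (velocity A I C t) (velocity A I C t) = 0 \<and> velocity A I C t \<noteq> 0)"

definition legendre_curve ::
  "'m topology \<Rightarrow> 'm chart set \<Rightarrow> ('m \<Rightarrow> 'm tvec \<Rightarrow> real) \<Rightarrow> real set \<Rightarrow> (real \<Rightarrow> 'm) \<Rightarrow> bool" where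
  "legendre_curve T A \<eta> I C \<longleftrightarrow> smooth_curve T A I C \<and> (\<forall>t\<in>I. \<eta> (C t) (velocity A I C t) = 0)"


section \<open>Frenet frames\<close>

text \<open>The frame is \<open>{velocity, N, W}\<close>; the screen vector bundle of the curve is spanned by \<open>W\<close>.\<close>

definition frenet_frame ::
  "'m chart set \<Rightarrow> ('m \<Rightarrow> 'm tvec \<Rightarrow> 'm tvec \<Rightarrow> real) \<Rightarrow> real set \<Rightarrow> (real \<Rightarrow> 'm) \<Rightarrow>
   (real \<Rightarrow> 'm tvec) \<Rightarrow> (real \<Rightarrow> 'm tvec) \<Rightarrow> bool" where
  "frenet_frame A g I C N W \<longleftrightarrow> field_along A I C N \<and> field_along A I C W \<and>
     (\<forall>t\<in>I. g (C t) (velocity A I C t) (N t) = 1 \<and> g (C t) (W t) (W t) = 1 \<and>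
        g (C t) (N t) (N t) = 0 \<and> g (C t) (N t) (W t) = 0 \<and>
        g (C t) (velocity A I C t) (W t) = 0)"

definition frenet_equations ::
  "'m chart set \<Rightarrow> 'm connection \<Rightarrow> real set \<Rightarrow> (real \<Rightarrow> 'm) \<Rightarrow> (real \<Rightarrow> 'm tvec) \<Rightarrow> (real \<Rightarrow> 'm tvec) \<Rightarrow>
   (real \<Rightarrow> real) \<Rightarrow> (real \<Rightarrow> real) \<Rightarrow> (real \<Rightarrow> real) \<Rightarrow> bool" where
  "frenet_equations A D I C N W h k1 k2 \<longleftrightarrow> (\<forall>t\<in>I.
     cov_deriv_along A D I C (velocity A I C) t = h t *\<^sub>R velocity A I C t + k1 t *\<^sub>R W t \<and>
     cov_deriv_along A D I C N t = - h t *\<^sub>R N t + k2 t *\<^sub>R W t \<and>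
     cov_deriv_along A D I C W t = - k2 t *\<^sub>R velocity A I C t - k1 t *\<^sub>R N t)"

text \<open>The parameter of \<open>C\<close> is distinguished for the frame if the function \<open>h\<close> of the frame, which is
  uniquely determined on \<open>I\<close> by the Frenet equations, vanishes.\<close>

definition distinguished_parameter ::
  "'m chart set \<Rightarrow> 'm connection \<Rightarrow> real set \<Rightarrow> (real \<Rightarrow> 'm) \<Rightarrow> (real \<Rightarrow> 'm tvec) \<Rightarrow> (real \<Rightarrow> 'm tvec) \<Rightarrow> bool" where
  "distinguished_parameter A D I C N W \<longleftrightarrow>
     (\<exists>h k1 k2. frenet_equations A D I C N W h k1 k2 \<and> (\<forall>t\<in>I. h t = 0))"

end

theory Submission
  imports Defs
begin

text \<open>
  The vectors \<open>C'\<close>, \<open>\<phi> C'\<close> and \<open>\<xi>\<close> form a frame along a Legendre null curve.  Their only nonzero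
  products are \<open>g(C', \<phi> C') = b\<close> and \<open>g(\<xi>, \<xi>) = 1\<close>, and \<open>b\<close> never vanishes, for otherwise the nonzero
  vector \<open>C'\<close> would be orthogonal to the whole tangent space (\<open>frame_metric\<close>, \<open>comb_spans\<close>,
  \<open>b_nonzero\<close>).  A tangent vector is therefore known from its products with the three frame vectors,
  and the structure equations of the frame follow:

  \<^item> The Sasaki-like condition applied to \<open>\<phi> \<xi> = 0\<close> gives \<open>\<nabla>\<xi> = -\<phi> C'\<close> (\<open>cov_reeb\<close>).
  \<^item> Differentiating \<open>g(C', C') = 0\<close>, \<open>g(C', \<xi>) = 0\<close> and \<open>g(C', \<phi> C') = b\<close> determines the three products
    of \<open>\<nabla>C'\<close>, hence \<open>\<nabla>C' = b' / (2 b) C' + b \<xi>\<close> (\<open>cov_velocity\<close>).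
  \<^item> The Sasaki-like condition reads \<open>\<nabla>(\<phi> C') = \<phi> \<nabla>C'\<close> on the null Legendre field \<open>C'\<close>
    (\<open>cov_phi_vel\<close>).

  Both screens of the corollary are spanned by a field \<open>\<delta> (\<xi> + f C')\<close> with \<open>\<delta> = \<plusminus>1\<close>: the first one
  has \<open>f = 0\<close>, the second one \<open>f = b' / (2 b\<^sup>2)\<close>.  For arbitrary smooth \<open>f\<close> the orthogonality relations
  force \<open>N = -f\<^sup>2/2 C' + (1/b) \<phi> C' - f \<xi>\<close>, and the structure equations give

  \<^item> \<open>h = b' / (2 b) - b f\<close>,
  \<^item> \<open>k\<^sub>1 = \<delta> b\<close>,
  \<^item> \<open>k\<^sub>2 = \<delta> (b f\<^sup>2 / 2 - f' - f b' / (2 b))\<close>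

  (\<open>frenet_frame_unique\<close>, \<open>frenet_equations_screen\<close>).  The second screen is exactly the one for which
  \<open>h\<close> vanishes.

  The covariant derivative along the curve is given by a formula in one chart.  Its product rules
  with functions, with \<open>g\<close> and with \<open>\<phi>\<close> (\<open>cov_scaleR\<close>, \<open>dt_metric\<close>, \<open>cov_phi\<close>) are obtained by expanding
  the fields in the coordinate fields of that chart, to which the axioms of the connection
  apply.  That \<open>N\<close> and \<open>W\<close> are smooth fields along the curve requires a calculus of the smooth
  functions on relatively open subsets of an interval, including its end points.
\<close>

section \<open>Smooth functions on sets with unique derivatives\<close>

text \<open>
  A derivative within a thick set is unique, since every point of the set is approached along all
  coordinate axes.  Open sets and non-degenerate intervals are both thick, so that coordinate
  domains and parameter intervals are treated together.
\<close>

definition thick :: "'a::euclidean_space set \<Rightarrow> bool" where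
  "thick S \<longleftrightarrow> (\<forall>x\<in>S. \<forall>i\<in>Basis. \<forall>e>0. \<exists>d. 0 < \<bar>d\<bar> \<and> \<bar>d\<bar> < e \<and> x + d *\<^sub>R i \<in> S)"

lemma frechet_derivative_within_eq:
  assumes "thick S" "x \<in> S" "(f has_derivative F) (at x within S)"
  shows "frechet_derivative f (at x within S) = F"
proof -
  have "(f has_derivative frechet_derivative f (at x within S)) (at x within S)"
    using assms(3) frechet_derivative_works differentiable_def by blast
  then show ?thesis
    by (rule frechet_derivative_unique_within[OF _ assms(3)])
      (use assms(1,2) in \<open>auto simp: thick_def\<close>)
qed

lemma thick_open:
  fixes S :: "'a::euclidean_space set"
  assumes "open S" shows "thick S"
  unfolding thick_def
proof (intro ballI allI impI)
  fix x i :: 'a and e :: real assume "x \<in> S" "i \<in> Basis" "0 < e"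
  then obtain r where r: "0 < r" "ball x r \<subseteq> S"
    using assms openE by blast
  show "\<exists>d. 0 < \<bar>d\<bar> \<and> \<bar>d\<bar> < e \<and> x + d *\<^sub>R i \<in> S"
  proof (intro exI conjI)
    let ?d = "min e r / 2"
    show "0 < \<bar>?d\<bar>" "\<bar>?d\<bar> < e" using \<open>0 < e\<close> r by auto
    have "x + ?d *\<^sub>R i \<in> ball x r" using \<open>i \<in> Basis\<close> r \<open>0 < e\<close> by (simp add: dist_norm)
    then show "x + ?d *\<^sub>R i \<in> S" using r by blast
  qed
qed

lemma thick_if_perfect:
  fixes S :: "real set"
  assumes "\<And>x. x \<in> S \<Longrightarrow> x islimpt S"
  shows "thick S"
  unfolding thick_def
proof (intro ballI allI impI)
  fix x i e :: real assume "x \<in> S" "i \<in> Basis" "0 < e"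
  then obtain y where y: "y \<in> S" "y \<noteq> x" "dist y x < e"
    using assms islimpt_approachable by blast
  with \<open>i \<in> Basis\<close> show "\<exists>d. 0 < \<bar>d\<bar> \<and> \<bar>d\<bar> < e \<and> x + d *\<^sub>R i \<in> S"
    by (intro exI[of _ "y - x"]) (auto simp: dist_real_def)
qed

lemma C_on_cong:
  assumes "\<And>x. x \<in> S \<Longrightarrow> f x = g x"
  shows "C_on k S f \<longleftrightarrow> C_on k S g"
  using assms
proof (induction k arbitrary: f g)
  case 0 then show ?case by (auto intro!: continuous_on_cong)
next
  case (Suc m)
  have *: "(f has_derivative F) (at x within S) \<longleftrightarrow> (g has_derivative F) (at x within S)"
    if "x \<in> S" for x F
    using Suc.prems that has_derivative_transform[of x S f g F] has_derivative_transform[of x S g f F]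
    by auto
  have "f differentiable (at x within S) \<longleftrightarrow> g differentiable (at x within S)" if "x \<in> S" for x
    unfolding differentiable_def using * that by simp
  moreover have "C_on m S (\<lambda>x. frechet_derivative f (at x within S) v) \<longleftrightarrow>
    C_on m S (\<lambda>x. frechet_derivative g (at x within S) v)" for v
    unfolding frechet_derivative_def using * by (intro Suc.IH) simp
  ultimately show ?case by simp
qed

text \<open>
  Uniqueness of derivatives allows the derivative in the definition of \<open>C_on\<close> to be replaced by any
  family of derivatives that happens to be at hand.
\<close>

lemma C_on_SucI:
  assumes "thick S"
    and "\<And>x. x \<in> S \<Longrightarrow> (f has_derivative F x) (at x within S)"
    and "\<And>v. C_on k S (\<lambda>x. F x v)"
  shows "C_on (Suc k) S f"
proof -
  have "frechet_derivative f (at x within S) = F x" if "x \<in> S" for x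
    using frechet_derivative_within_eq assms that by blast
  then have "C_on k S (\<lambda>x. frechet_derivative f (at x within S) v)" for v
    using assms(3)[of v] by (subst C_on_cong[where g = "\<lambda>x. F x v"]) auto
  then show ?thesis using assms(2) by (auto simp: differentiable_def)
qed

lemma C_on_SucD:
  assumes "C_on (Suc k) S f"
  obtains F where "\<And>x. x \<in> S \<Longrightarrow> (f has_derivative F x) (at x within S)"
    and "\<And>v. C_on k S (\<lambda>x. F x v)"
proof
  show "(f has_derivative frechet_derivative f (at x within S)) (at x within S)" if "x \<in> S" for x
    using assms that frechet_derivative_works by auto
  show "C_on k S (\<lambda>x. frechet_derivative f (at x within S) v)" for v
    using assms by simp
qed

lemma C_on_mono: "C_on (Suc k) S f \<Longrightarrow> C_on k S f"
proof (induction k arbitrary: f)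
  case 0 then show ?case
    by (auto simp: continuous_on_eq_continuous_within dest: differentiable_imp_continuous_within)
next
  case (Suc k)
  show ?case unfolding C_on.simps(2)[of k]
    using Suc.prems Suc.IH by (auto simp del: C_on.simps(2)) (auto simp: C_on.simps(2)[of "Suc k"])
qed

lemma C_on_const:
  assumes "thick S" shows "C_on k S (\<lambda>x. c)"
proof (induction k arbitrary: c)
  case (Suc k) then show ?case by (intro C_on_SucI[OF assms, where F = "\<lambda>x v. 0"]) auto
qed simp

lemma C_on_add:
  assumes "thick S" "C_on k S f" "C_on k S g" shows "C_on k S (\<lambda>x. f x + g x)"
  using assms(2,3)
proof (induction k arbitrary: f g)
  case (Suc k)
  obtain F where F: "\<And>x. x \<in> S \<Longrightarrow> (f has_derivative F x) (at x within S)" "\<And>v. C_on k S (\<lambda>x. F x v)"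
    using C_on_SucD[OF Suc.prems(1)] by blast
  obtain G where G: "\<And>x. x \<in> S \<Longrightarrow> (g has_derivative G x) (at x within S)" "\<And>v. C_on k S (\<lambda>x. G x v)"
    using C_on_SucD[OF Suc.prems(2)] by blast
  show ?case
    by (rule C_on_SucI[OF assms(1), where F = "\<lambda>x v. F x v + G x v"])
      (use F G in \<open>auto intro: has_derivative_add Suc.IH\<close>)
qed (auto intro: continuous_on_add)

lemma C_on_bounded_linear:
  assumes "thick S" "bounded_linear h" "C_on k S f" shows "C_on k S (\<lambda>x. h (f x))"
  using assms(3)
proof (induction k arbitrary: f)
  case 0 then show ?case using assms(2) by (auto intro: bounded_linear.continuous_on)
next
  case (Suc k)
  obtain F where F: "\<And>x. x \<in> S \<Longrightarrow> (f has_derivative F x) (at x within S)" "\<And>v. C_on k S (\<lambda>x. F x v)"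
    using C_on_SucD[OF Suc.prems(1)] by blast
  show ?case
    by (rule C_on_SucI[OF assms(1), where F = "\<lambda>x v. h (F x v)"])
      (use F assms(2) in \<open>auto intro: bounded_linear.has_derivative Suc.IH\<close>)
qed

lemma C_on_scaleR:
  assumes "thick S" "C_on k S f" "C_on k S g" shows "C_on k S (\<lambda>x. f x *\<^sub>R g x)"
  using assms(2,3)
proof (induction k arbitrary: f g)
  case (Suc k)
  obtain F where F: "\<And>x. x \<in> S \<Longrightarrow> (f has_derivative F x) (at x within S)" "\<And>v. C_on k S (\<lambda>x. F x v)"
    using C_on_SucD[OF Suc.prems(1)] by blast
  obtain G where G: "\<And>x. x \<in> S \<Longrightarrow> (g has_derivative G x) (at x within S)" "\<And>v. C_on k S (\<lambda>x. G x v)"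
    using C_on_SucD[OF Suc.prems(2)] by blast
  note fg = C_on_mono[OF Suc.prems(1)] C_on_mono[OF Suc.prems(2)]
  show ?case
    by (rule C_on_SucI[OF assms(1), where F = "\<lambda>x v. f x *\<^sub>R G x v + F x v *\<^sub>R g x"])
      (use F G fg assms(1) in \<open>auto intro!: has_derivative_scaleR C_on_add Suc.IH\<close>)
qed (auto intro: continuous_on_scaleR)

lemma C_on_sum:
  assumes "thick S" "\<And>i. i \<in> J \<Longrightarrow> C_on k S (f i)" shows "C_on k S (\<lambda>x. \<Sum>i\<in>J. f i x)"
  using assms(2)
  by (induction J rule: infinite_finite_induct) (auto intro: C_on_add C_on_const assms(1))

lemma C_on_inverse:
  fixes f :: "'a::euclidean_space \<Rightarrow> real"
  assumes "thick S" "C_on k S f" "\<And>x. x \<in> S \<Longrightarrow> f x \<noteq> 0" shows "C_on k S (\<lambda>x. inverse (f x))"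
  using assms(2)
proof (induction k)
  case 0 then show ?case using assms(3) by (auto intro: continuous_on_inverse)
next
  case (Suc k)
  obtain F where F: "\<And>x. x \<in> S \<Longrightarrow> (f has_derivative F x) (at x within S)" "\<And>v. C_on k S (\<lambda>x. F x v)"
    using C_on_SucD[OF Suc.prems(1)] by blast
  note inv = Suc.IH[OF C_on_mono[OF Suc.prems(1)]]
  have "C_on k S (\<lambda>x. (-1) *\<^sub>R (inverse (f x) *\<^sub>R F x v *\<^sub>R inverse (f x)))" for v
    by (intro C_on_scaleR C_on_const assms(1) inv F)
  then show ?case
    by (intro C_on_SucI[OF assms(1), where F = "\<lambda>x v. - (inverse (f x) * F x v * inverse (f x))"])
      (use F(1) assms(3) Deriv.has_derivative_inverse[where f = f] in \<open>auto simp: mult.assoc\<close>)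
qed

text \<open>
  In \<open>Dh (f x) (Df x v)\<close> the point and the direction vary simultaneously, so the induction hypothesis
  does not apply to it directly.  Expanding the direction in the basis separates the two: the
  result is a sum of products of components of \<open>Df x v\<close> with partial derivatives of \<open>h\<close> along \<open>f\<close>.
\<close>

lemma C_on_compose:
  fixes f :: "'a::euclidean_space \<Rightarrow> 'b::euclidean_space"
  assumes "thick S" "C_on k S f" "C_on k U h" "f ` S \<subseteq> U"
  shows "C_on k S (\<lambda>x. h (f x))"
  using assms(2,3)
proof (induction k arbitrary: h)
  case 0 then show ?case using assms(4) by (auto intro: continuous_on_compose2)
next
  case (Suc k)
  obtain F where F: "\<And>x. x \<in> S \<Longrightarrow> (f has_derivative F x) (at x within S)" "\<And>v. C_on k S (\<lambda>x. F x v)"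
    using C_on_SucD[OF Suc.prems(1)] by blast
  obtain H where H: "\<And>x. x \<in> U \<Longrightarrow> (h has_derivative H x) (at x within U)" "\<And>v. C_on k U (\<lambda>x. H x v)"
    using C_on_SucD[OF Suc.prems(2)] by blast
  have H_comp: "C_on k S (\<lambda>x. H (f x) v)" for v
    using Suc.IH[OF C_on_mono[OF Suc.prems(1)] H(2)] .
  have "C_on k S (\<lambda>x. \<Sum>i\<in>Basis. (F x v \<bullet> i) *\<^sub>R H (f x) i)" for v
    by (intro C_on_sum C_on_scaleR C_on_bounded_linear[OF _ bounded_linear_inner_left] assms(1) F H_comp)
  moreover have "((\<lambda>x. h (f x)) has_derivative (\<lambda>v. \<Sum>i\<in>Basis. (F x v \<bullet> i) *\<^sub>R H (f x) i)) (at x within S)"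
    if "x \<in> S" for x
  proof -
    have fx: "f x \<in> U" using assms(4) that by blast
    have "((\<lambda>x. h (f x)) has_derivative (\<lambda>v. H (f x) (F x v))) (at x within S)"
      using has_derivative_in_compose2[of U h H f S x "F x"] H(1) F(1) assms(4) that by blast
    moreover have "H (f x) (F x v) = (\<Sum>i\<in>Basis. (F x v \<bullet> i) *\<^sub>R H (f x) i)" for v
    proof -
      interpret linear "H (f x)" using H(1)[OF fx] has_derivative_linear by blast
      have "H (f x) (F x v) = H (f x) (\<Sum>i\<in>Basis. (F x v \<bullet> i) *\<^sub>R i)"
        by (simp add: euclidean_representation)
      then show ?thesis by (simp add: sum scale)
    qed
    ultimately show ?thesis by simp
  qed
  ultimately show ?case by (intro C_on_SucI[OF assms(1)])
qed

lemma C_on_open_subset: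
  assumes "open S" "open U" "U \<subseteq> S" "C_on k S f" shows "C_on k U f"
  using assms(4)
proof (induction k arbitrary: f)
  case 0 then show ?case using assms(3) continuous_on_subset by auto
next
  case (Suc k)
  have "at x within S = at x within U" if "x \<in> U" for x
    using assms(1-3) that by (metis at_within_open subsetD)
  then have eq: "at x within U = at x within S" if "x \<in> U" for x
    using that by simp
  have "C_on k U (\<lambda>x. frechet_derivative f (at x within U) v)" for v
    using Suc.IH[of "\<lambda>x. frechet_derivative f (at x within S) v"] Suc.prems
    by (subst C_on_cong[where g = "\<lambda>x. frechet_derivative f (at x within S) v"]) (simp_all add: eq)
  moreover have "f differentiable (at x within U)" if "x \<in> U" for x
    using Suc.prems assms(3) that by (auto simp: eq)
  ultimately show ?case by simp
qed

lemma smooth_on_differentiable: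
  assumes "smooth_on S f" "x \<in> S" shows "f differentiable (at x within S)"
proof -
  have "C_on (Suc 0) S f" using assms(1) by (simp add: smooth_on_def del: C_on.simps)
  then show ?thesis using assms(2) by simp
qed

lemma smooth_on_has_derivative:
  assumes "smooth_on S f" "open S" "x \<in> S"
  shows "(f has_derivative frechet_derivative f (at x)) (at x)"
  using smooth_on_differentiable[OF assms(1,3)] at_within_open[OF assms(3,2)]
  by (simp add: frechet_derivative_works[symmetric])

lemma smooth_on_cong:
  assumes "\<And>x. x \<in> S \<Longrightarrow> f x = g x" shows "smooth_on S f \<longleftrightarrow> smooth_on S g"
  by (simp add: smooth_on_def C_on_cong[of S f g, OF assms])

lemma smooth_on_transform:
  "\<lbrakk>smooth_on S f; \<And>x. x \<in> S \<Longrightarrow> f x = g x\<rbrakk> \<Longrightarrow> smooth_on S g"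
  using smooth_on_cong[of S f g] by simp

lemma smooth_on_frechet_derivative:
  assumes "smooth_on S f" shows "smooth_on S (\<lambda>x. frechet_derivative f (at x within S) v)"
  unfolding smooth_on_def
proof
  fix k
  have "C_on (Suc k) S f" using assms by (simp add: smooth_on_def del: C_on.simps)
  then show "C_on k S (\<lambda>x. frechet_derivative f (at x within S) v)" by simp
qed

lemma smooth_on_const: "thick S \<Longrightarrow> smooth_on S (\<lambda>x. c)"
  by (simp add: smooth_on_def C_on_const)

lemma smooth_on_add: "thick S \<Longrightarrow> smooth_on S f \<Longrightarrow> smooth_on S g \<Longrightarrow> smooth_on S (\<lambda>x. f x + g x)"
  by (simp add: smooth_on_def C_on_add)

lemma smooth_on_bounded_linear:
  "thick S \<Longrightarrow> bounded_linear h \<Longrightarrow> smooth_on S f \<Longrightarrow> smooth_on S (\<lambda>x. h (f x))"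
  by (simp add: smooth_on_def C_on_bounded_linear)

lemma smooth_on_scaleR:
  "thick S \<Longrightarrow> smooth_on S f \<Longrightarrow> smooth_on S g \<Longrightarrow> smooth_on S (\<lambda>x. f x *\<^sub>R g x)"
  by (simp add: smooth_on_def C_on_scaleR)

lemma smooth_on_sum:
  "thick S \<Longrightarrow> (\<And>i. i \<in> J \<Longrightarrow> smooth_on S (f i)) \<Longrightarrow> smooth_on S (\<lambda>x. \<Sum>i\<in>J. f i x)"
  by (simp add: smooth_on_def C_on_sum)

lemma smooth_on_inverse:
  fixes f :: "'a::euclidean_space \<Rightarrow> real"
  shows "thick S \<Longrightarrow> smooth_on S f \<Longrightarrow> (\<And>x. x \<in> S \<Longrightarrow> f x \<noteq> 0) \<Longrightarrow> smooth_on S (\<lambda>x. inverse (f x))"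
  by (simp add: smooth_on_def C_on_inverse)

lemma smooth_on_compose:
  fixes f :: "'a::euclidean_space \<Rightarrow> 'b::euclidean_space"
  shows "thick S \<Longrightarrow> smooth_on S f \<Longrightarrow> smooth_on U h \<Longrightarrow> f ` S \<subseteq> U \<Longrightarrow> smooth_on S (\<lambda>x. h (f x))"
  unfolding smooth_on_def by (blast intro: C_on_compose)

lemma smooth_on_open_subset:
  "open S \<Longrightarrow> open U \<Longrightarrow> U \<subseteq> S \<Longrightarrow> smooth_on S f \<Longrightarrow> smooth_on U f"
  unfolding smooth_on_def by (blast intro: C_on_open_subset)

section \<open>Tangent vectors and coordinate fields of a 3-manifold\<close>

lemma sum_fun_apply: "(\<Sum>i\<in>J. f i) x = (\<Sum>i\<in>J. f i x)"
  for f :: "'i \<Rightarrow> 'a \<Rightarrow> 'b::comm_monoid_add"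
  by (induction J rule: infinite_finite_induct) auto

lemma scaleR_fun_apply [simp]: "(a *\<^sub>R f) x = a *\<^sub>R f x"
  by (simp add: scaleR_fun_def)

locale manifold_3 =
  fixes T :: "'m topology" and A :: "'m chart set"
  assumes smooth_3_manifold: "smooth_3_manifold T A"
begin

lemma openin_dom_chart: "c \<in> A \<Longrightarrow> openin T (dom_chart c)"
  and homeomorphic_coords: "c \<in> A \<Longrightarrow>
    homeomorphic_map (subtopology T (dom_chart c)) (top_of_set (coords c ` dom_chart c)) (coords c)"
  and open_coords_dom: "c \<in> A \<Longrightarrow> open (coords c ` dom_chart c)"
  and smooth_transition: "\<lbrakk>c \<in> A; d \<in> A\<rbrakk> \<Longrightarrow>
    smooth_on (coords c ` (dom_chart c \<inter> dom_chart d)) (transition c d)"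
  using smooth_3_manifold by (auto simp: smooth_3_manifold_def is_chart_def)

lemma chart_inv_coords [simp]:
  assumes "c \<in> A" "p \<in> dom_chart c" shows "chart_inv c (coords c p) = p"
proof -
  have "inj_on (coords c) (dom_chart c)"
    using homeomorphic_imp_injective_map[OF homeomorphic_coords[OF assms(1)]]
      openin_subset[OF openin_dom_chart[OF assms(1)]]
    by (simp add: Int_absorb1)
  then show ?thesis using assms(2) by (simp add: chart_inv_def)
qed

lemma transition_coords [simp]:
  "\<lbrakk>c \<in> A; p \<in> dom_chart c\<rbrakk> \<Longrightarrow> transition c d (coords c p) = coords d p"
  by (simp add: transition_def)

lemma open_coords_image:
  assumes "c \<in> A" "openin T U" shows "open (coords c ` (U \<inter> dom_chart c))"
proof -
  have "openin (subtopology T (dom_chart c)) (U \<inter> dom_chart c)"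
    using assms(2) by (auto simp: openin_subtopology)
  then have "openin (top_of_set (coords c ` dom_chart c)) (coords c ` (U \<inter> dom_chart c))"
    using homeomorphic_imp_open_map[OF homeomorphic_coords[OF assms(1)]] by (simp add: open_map_def)
  then show ?thesis using open_coords_dom[OF assms(1)] openin_open_trans by blast
qed

lemma charts_atD: "c \<in> charts_at A p \<Longrightarrow> c \<in> A" "c \<in> charts_at A p \<Longrightarrow> p \<in> dom_chart c"
  by (auto simp: charts_at_def)

lemma some_chart: "p \<in> topspace T \<Longrightarrow> some_chart A p \<in> charts_at A p"
proof -
  assume "p \<in> topspace T"
  then have "p \<in> (\<Union>c\<in>A. dom_chart c)" using smooth_3_manifold by (simp add: smooth_3_manifold_def)
  then obtain c where "c \<in> charts_at A p" by (auto simp: charts_at_def)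
  then show ?thesis unfolding some_chart_def by (rule someI)
qed

abbreviation jac :: "'m chart \<Rightarrow> 'm chart \<Rightarrow> 'm \<Rightarrow> real^3 \<Rightarrow> real^3" where
  "jac c d p \<equiv> frechet_derivative (transition c d) (at (coords c p))"

lemma has_derivative_transition:
  assumes "c \<in> charts_at A p" "d \<in> charts_at A p"
  shows "(transition c d has_derivative jac c d p) (at (coords c p))"
proof (rule smooth_on_has_derivative[OF smooth_transition])
  show "open (coords c ` (dom_chart c \<inter> dom_chart d))"
    using open_coords_image[of c "dom_chart d"] openin_dom_chart assms
    by (simp add: charts_at_def Int_commute)
qed (use assms in \<open>auto simp: charts_at_def\<close>)

lemma linear_jac:
  "\<lbrakk>c \<in> charts_at A p; d \<in> charts_at A p\<rbrakk> \<Longrightarrow> linear (jac c d p)"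
  using has_derivative_transition has_derivative_linear by blast

text \<open>
  The cocycle rule of the Jacobians is the chain rule for \<open>transition d e \<circ> transition c d\<close>, which
  agrees with \<open>transition c e\<close> on the coordinates of the common domain of the three charts.
\<close>

lemma jac_chain:
  assumes "c \<in> charts_at A p" "d \<in> charts_at A p" "e \<in> charts_at A p"
  shows "jac d e p (jac c d p v) = jac c e p v"
proof -
  let ?U = "coords c ` (dom_chart d \<inter> dom_chart e \<inter> dom_chart c)"
  have cA: "c \<in> A" "p \<in> dom_chart c" using charts_atD[OF assms(1)] .
  have U: "open ?U" by (intro open_coords_image openin_Int openin_dom_chart charts_atD[OF assms(1)]
    charts_atD[OF assms(2)] charts_atD[OF assms(3)])
  have "(transition d e has_derivative jac d e p) (at (transition c d (coords c p)))"
    using has_derivative_transition[OF assms(2,3)] cA by simp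
  from diff_chain_at[OF has_derivative_transition[OF assms(1,2)] this]
  have "(transition c e has_derivative (jac d e p \<circ> jac c d p)) (at (coords c p))"
    by (rule has_derivative_transform_within_open[OF _ U])
      (use cA assms in \<open>auto simp: charts_at_def\<close>)
  then show ?thesis by (simp add: frechet_derivative_at[symmetric])
qed

lemma jac_self: 
  assumes "c \<in> charts_at A p" shows "jac c c p v = v"
proof -
  have "((\<lambda>x. x) has_derivative (\<lambda>x. x)) (at (coords c p))" by simp
  then have "(transition c c has_derivative (\<lambda>x. x)) (at (coords c p))"
    by (rule has_derivative_transform_within_open[OF _ open_coords_dom[of c]])
      (use assms in \<open>auto simp: charts_at_def\<close>)
  then show ?thesis by (simp add: frechet_derivative_at[symmetric])
qed

lemma tangent_jac:
  "\<lbrakk>v \<in> tangent_space A p; c \<in> charts_at A p; d \<in> charts_at A p\<rbrakk> \<Longrightarrow> v d = jac c d p (v c)"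
  unfolding tangent_space_def by blast

lemma tangent_outside: "\<lbrakk>v \<in> tangent_space A p; c \<notin> charts_at A p\<rbrakk> \<Longrightarrow> v c = 0"
  unfolding tangent_space_def by blast

text \<open>
  The components in one chart around \<open>p\<close> determine those in all charts, hence the vector.  Three
  dimensional linear algebra thereby transfers from \<open>real^3\<close> to the tangent space.
\<close>

lemma tangent_eqI:
  assumes "v \<in> tangent_space A p" "w \<in> tangent_space A p" "c \<in> charts_at A p" "v c = w c"
  shows "v = w"
proof
  fix d show "v d = w d"
  proof (cases "d \<in> charts_at A p")
    case True
    with assms(1-3) show ?thesis
      using tangent_jac[of v p c d] tangent_jac[of w p c d] assms(4) by metis
  qed (simp add: tangent_outside[OF assms(1)] tangent_outside[OF assms(2)])
qed

lemma tangent_spaceI: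
  assumes "\<And>c d. \<lbrakk>c \<in> charts_at A p; d \<in> charts_at A p\<rbrakk> \<Longrightarrow> v d = jac c d p (v c)"
    and "\<And>c. c \<notin> charts_at A p \<Longrightarrow> v c = 0"
  shows "v \<in> tangent_space A p"
  unfolding tangent_space_def using assms by blast

lemma tangent_zero: "0 \<in> tangent_space A p"
  by (rule tangent_spaceI) (simp_all add: linear_0[OF linear_jac])

lemma tangent_add: "\<lbrakk>v \<in> tangent_space A p; w \<in> tangent_space A p\<rbrakk> \<Longrightarrow> v + w \<in> tangent_space A p"
  by (rule tangent_spaceI) (auto simp: linear_add[OF linear_jac] tangent_outside tangent_jac[symmetric])

lemma tangent_scaleR: "v \<in> tangent_space A p \<Longrightarrow> a *\<^sub>R v \<in> tangent_space A p"
  by (rule tangent_spaceI) (auto simp: linear_scale[OF linear_jac] tangent_outside tangent_jac[symmetric])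

lemma tangent_uminus: "v \<in> tangent_space A p \<Longrightarrow> - v \<in> tangent_space A p"
  using tangent_scaleR[of v p "-1"] by simp

lemma tangent_diff: "\<lbrakk>v \<in> tangent_space A p; w \<in> tangent_space A p\<rbrakk> \<Longrightarrow> v - w \<in> tangent_space A p"
  using tangent_add[OF _ tangent_uminus, of v p w] by simp

lemma tangent_sum: "(\<And>i. i \<in> J \<Longrightarrow> v i \<in> tangent_space A p) \<Longrightarrow> (\<Sum>i\<in>J. v i) \<in> tangent_space A p"
  by (induction J rule: infinite_finite_induct) (auto intro: tangent_add simp: tangent_zero)

lemmas tangent_closed = tangent_zero tangent_add tangent_scaleR tangent_uminus tangent_diff tangent_sum

lemma coord_field_tangent: "c \<in> charts_at A p \<Longrightarrow> coord_field A c j p \<in> tangent_space A p"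
  by (rule tangent_spaceI) (simp_all add: coord_field_def jac_chain)

lemma coord_field_self: "c \<in> charts_at A p \<Longrightarrow> coord_field A c j p c = axis j 1"
  by (simp add: coord_field_def jac_self)

lemma tangent_expand:
  assumes "v \<in> tangent_space A p" "c \<in> charts_at A p"
  shows "v = (\<Sum>j\<in>UNIV. v c $ j *\<^sub>R coord_field A c j p)"
proof (rule tangent_eqI[OF assms(1) _ assms(2)])
  show "(\<Sum>j\<in>UNIV. v c $ j *\<^sub>R coord_field A c j p) \<in> tangent_space A p"
    by (intro tangent_closed coord_field_tangent assms)
  show "v c = (\<Sum>j\<in>UNIV. v c $ j *\<^sub>R coord_field A c j p) c"
    by (simp add: sum_fun_apply coord_field_self[OF assms(2)] vec_eq_iff axis_def if_distrib cong: if_cong)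
qed

lemma thick_coords_image: "\<lbrakk>c \<in> A; openin T U\<rbrakk> \<Longrightarrow> thick (coords c ` (U \<inter> dom_chart c))"
  by (intro thick_open open_coords_image)

lemma vector_field_subset:
  assumes "vector_field A U X" "openin T U" "openin T V" "V \<subseteq> U"
  shows "vector_field A V X"
  unfolding vector_field_def
proof (intro conjI ballI)
  fix c assume "c \<in> A"
  show "smooth_on (coords c ` (V \<inter> dom_chart c)) (\<lambda>x. X (chart_inv c x) c)"
    by (rule smooth_on_open_subset[OF open_coords_image[OF \<open>c \<in> A\<close> assms(2)] open_coords_image[OF \<open>c \<in> A\<close> assms(3)]])
      (use assms \<open>c \<in> A\<close> in \<open>auto simp: vector_field_def\<close>)
qed (use assms in \<open>auto simp: vector_field_def\<close>)

lemma vector_field_add: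
  assumes "openin T U" "vector_field A U X" "vector_field A U Y"
  shows "vector_field A U (\<lambda>p. X p + Y p)"
  using assms by (auto simp: vector_field_def intro!: tangent_add smooth_on_add thick_coords_image)

lemma vector_field_scaleR:
  assumes "openin T U" "smooth_function A U f" "vector_field A U X"
  shows "vector_field A U (\<lambda>p. f p *\<^sub>R X p)"
  using assms by (auto simp: vector_field_def smooth_function_def comp_def
      intro!: tangent_scaleR smooth_on_scaleR thick_coords_image)

text \<open>
  In a chart \<open>d\<close> the components of \<open>coord_field A c j\<close> are the \<open>j\<close>-th column of the Jacobian of
  \<open>transition c d\<close>, evaluated at the \<open>c\<close>-coordinates of the point.  This is the composition of a
  derivative of the smooth map \<open>transition c d\<close> with the smooth map \<open>transition d c\<close>.
\<close>

lemma vector_field_coord_field: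
  assumes "c \<in> A" shows "vector_field A (dom_chart c) (coord_field A c j)"
  unfolding vector_field_def
proof (intro conjI ballI)
  fix p assume "p \<in> dom_chart c"
  then show "coord_field A c j p \<in> tangent_space A p"
    using assms by (intro coord_field_tangent) (simp add: charts_at_def)
next
  fix d assume d: "d \<in> A"
  let ?U = "coords d ` (dom_chart c \<inter> dom_chart d)" and ?V = "coords c ` (dom_chart c \<inter> dom_chart d)"
  have V: "open ?V"
    using open_coords_image[OF assms openin_dom_chart[OF d]] by (simp add: Int_commute)
  have U: "thick ?U" using thick_coords_image[OF d openin_dom_chart[OF assms]] .
  have jac_smooth: "smooth_on ?V (\<lambda>x. frechet_derivative (transition c d) (at x within ?V) (axis j 1))"
    by (intro smooth_on_frechet_derivative smooth_transition assms d)
  have trans_smooth: "smooth_on ?U (transition d c)"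
    using smooth_transition[OF d assms] by (simp add: Int_commute)
  have "transition d c ` ?U \<subseteq> ?V" using d by auto
  from smooth_on_compose[OF U trans_smooth jac_smooth this]
  have "smooth_on ?U (\<lambda>x. frechet_derivative (transition c d)
      (at (transition d c x) within ?V) (axis j 1))" .
  moreover have "coord_field A c j (chart_inv d x) d = frechet_derivative (transition c d)
      (at (transition d c x) within ?V) (axis j 1)" if x: "x \<in> ?U" for x
  proof -
    obtain p where p: "p \<in> dom_chart c" "p \<in> dom_chart d" "x = coords d p"
      using x by blast
    have "at (coords c p) within ?V = at (coords c p)"
      using V p by (intro at_within_open) auto
    then show ?thesis
      using p d assms by (simp add: coord_field_def charts_at_def)
  qed
  ultimately show "smooth_on ?U (\<lambda>x. coord_field A c j (chart_inv d x) d)"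
    by (simp cong: smooth_on_cong)
qed

lemma smooth_function_component:
  assumes "vector_field A U X" "openin T U" "c \<in> A" "U \<subseteq> dom_chart c"
  shows "smooth_function A U (\<lambda>q. X q c $ j)"
  unfolding smooth_function_def
proof
  fix d assume d: "d \<in> A"
  have *: "transition d c ` coords d ` (U \<inter> dom_chart d) \<subseteq> coords c ` (U \<inter> dom_chart c)"
    using d assms(4) by auto
  have comp: "smooth_on (coords c ` (U \<inter> dom_chart c)) (\<lambda>x. X (chart_inv c x) c $ j)"
    by (rule smooth_on_bounded_linear[OF thick_coords_image bounded_linear_vec_nth])
      (use assms in \<open>auto simp: vector_field_def\<close>)
  have "smooth_on (coords d ` (U \<inter> dom_chart d)) (transition d c)"
    using smooth_on_open_subset[OF open_coords_image[OF d openin_dom_chart[OF assms(3)]]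
        open_coords_image[OF d assms(2)]] smooth_transition[OF d assms(3)] assms(4)
    by (auto simp: Int_commute)
  from smooth_on_compose[OF thick_coords_image[OF d assms(2)] this comp *]
  have "smooth_on (coords d ` (U \<inter> dom_chart d)) (\<lambda>x. X (chart_inv c (transition d c x)) c $ j)" .
  then show "smooth_on (coords d ` (U \<inter> dom_chart d)) ((\<lambda>q. X q c $ j) \<circ> chart_inv d)"
    by (subst smooth_on_cong[where g = "\<lambda>x. X (chart_inv c (transition d c x)) c $ j"])
      (use d assms(3,4) in auto)
qed

end

section \<open>Differentiation along a curve\<close>

text \<open>
  The set \<open>times_in c\<close> collects the times that the curve spends in the domain of the chart \<open>c\<close>.
\<close>

locale curve_with_connection = manifold_3 T A for T :: "'m topology" and A +
  fixes D :: "'m connection" and I :: "real set" and C :: "real \<Rightarrow> 'm"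
  assumes affine_connection: "affine_connection T A D" and smooth_curve: "smooth_curve T A I C"
begin

abbreviation times_in :: "'m chart \<Rightarrow> real set" where
  "times_in c \<equiv> {t \<in> I. C t \<in> dom_chart c}"

abbreviation dt :: "(real \<Rightarrow> 'b::real_normed_vector) \<Rightarrow> real \<Rightarrow> 'b" where
  "dt f t \<equiv> vector_derivative f (at t within I)"

abbreviation vel :: "real \<Rightarrow> 'm tvec" where
  "vel \<equiv> velocity A I C"

abbreviation cov :: "(real \<Rightarrow> 'm tvec) \<Rightarrow> real \<Rightarrow> 'm tvec" where
  "cov \<equiv> cov_deriv_along A D I C"

lemma curve_in_topspace: "t \<in> I \<Longrightarrow> C t \<in> topspace T"
  using smooth_curve by (auto simp: smooth_curve_def continuous_map_def)

lemma islimpt_interval: "t \<in> I \<Longrightarrow> t islimpt I"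
proof (rule connected_imp_perfect)
  show "connected I" using smooth_curve by (simp add: smooth_curve_def is_interval_connected)
  show "I \<noteq> {x}" for x using smooth_curve interior_singleton by (auto simp: smooth_curve_def)
qed

lemma at_within_nontrivial: "t \<in> I \<Longrightarrow> at t within I \<noteq> bot"
  using islimpt_interval by (simp add: trivial_limit_within)

lemma times_in_open:
  assumes "c \<in> A" obtains Q where "open Q" "times_in c = I \<inter> Q"
proof -
  have "openin (top_of_set I) {t \<in> topspace (top_of_set I). C t \<in> dom_chart c}"
    using smooth_curve openin_dom_chart[OF assms]
    by (intro openin_continuous_map_preimage) (auto simp: smooth_curve_def)
  then show ?thesis using that by (auto simp: openin_open)
qed

text \<open>
  Derivatives may be computed on \<open>times_in c\<close>, where the chart applies, although they are defined
  within \<open>I\<close>.  At an end point of \<open>I\<close> both are one-sided.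
\<close>

lemma at_within_times_in:
  assumes "c \<in> A" "t \<in> times_in c" shows "at t within times_in c = at t within I"
proof -
  obtain Q where Q: "open Q" "times_in c = I \<inter> Q" using times_in_open[OF assms(1)] .
  show ?thesis by (rule at_within_nhd[of t Q]) (use Q assms(2) in auto)
qed

lemma thick_times_in: 
  assumes "c \<in> A" shows "thick (times_in c)"
proof (rule thick_if_perfect)
  fix t assume t: "t \<in> times_in c"
  then have "at t within times_in c \<noteq> bot"
    using at_within_times_in[OF assms t] at_within_nontrivial by simp
  then show "t islimpt times_in c" by (simp add: trivial_limit_within)
qed

lemma dt_eq: "\<lbrakk>(f has_vector_derivative y) (at t within I); t \<in> I\<rbrakk> \<Longrightarrow> dt f t = y"
  using vector_derivative_within at_within_nontrivial by blast

lemma has_vector_derivative_local: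
  assumes "c \<in> A" "t \<in> times_in c" "\<And>s. s \<in> times_in c \<Longrightarrow> f s = h s"
    and "(f has_vector_derivative y) (at t within I)"
  shows "(h has_vector_derivative y) (at t within I)"
  using assms(4) has_vector_derivative_transform[OF assms(2), of h f] assms(3)
  by (simp add: at_within_times_in[OF assms(1,2), symmetric])

lemma dt_local:
  assumes "c \<in> A" "t \<in> times_in c" "\<And>s. s \<in> times_in c \<Longrightarrow> f s = h s"
  shows "dt f t = dt h t"
  unfolding vector_derivative_def
  using has_vector_derivative_local[OF assms(1,2), of f h] has_vector_derivative_local[OF assms(1,2), of h f] assms(3)
  by metis

lemma smooth_on_has_dt:
  assumes "c \<in> A" "t \<in> times_in c" "smooth_on (times_in c) f"
  shows "(f has_vector_derivative dt f t) (at t within I)"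
  using smooth_on_differentiable[OF assms(3,2)] 
  by (simp add: at_within_times_in[OF assms(1,2)] vector_derivative_works)

lemma smooth_on_dt:
  assumes "c \<in> A" "smooth_on (times_in c) f" shows "smooth_on (times_in c) (dt f)"
proof -
  have "frechet_derivative f (at t within times_in c) 1 = dt f t" if t: "t \<in> times_in c" for t
  proof -
    have "(f has_derivative (\<lambda>h. h *\<^sub>R dt f t)) (at t within times_in c)"
      using smooth_on_has_dt[OF assms(1) t assms(2)] at_within_times_in[OF assms(1) t]
      by (simp add: has_vector_derivative_def)
    from frechet_derivative_within_eq[OF thick_times_in[OF assms(1)] t this] show ?thesis by simp
  qed
  then show ?thesis
    by (rule smooth_on_transform[OF smooth_on_frechet_derivative[OF assms(2), of 1]])
qed

lemma smooth_on_coords_curve: "c \<in> A \<Longrightarrow> smooth_on (times_in c) (coords c \<circ> C)"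
  using smooth_curve by (auto simp: smooth_curve_def)

lemma velocity_chart: "c \<in> charts_at A (C t) \<Longrightarrow> vel t c = dt (coords c \<circ> C) t"
  by (simp add: velocity_def)

text \<open>
  The chain rule for a function \<open>F\<close> on the manifold, passing through the coordinates of \<open>c\<close>.  It
  yields the transformation law of the velocity (\<open>F\<close> another coordinate map) as well as the
  derivatives of functions and of components of vector fields along the curve.
\<close>

lemma pullback_has_dt:
  assumes "c \<in> A" "t \<in> times_in c" "smooth_on (coords c ` (U \<inter> dom_chart c)) (F \<circ> chart_inv c)"
    and "openin T U" "C t \<in> U"
  shows "((\<lambda>s. F (C s)) has_vector_derivative
    frechet_derivative (F \<circ> chart_inv c) (at (coords c (C t))) (vel t c)) (at t within I)"
proof -
  let ?L = "frechet_derivative (F \<circ> chart_inv c) (at (coords c (C t)))"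
  have c: "c \<in> charts_at A (C t)" using assms(1,2) by (simp add: charts_at_def)
  have L: "(F \<circ> chart_inv c has_derivative ?L) (at (coords c (C t)))"
    by (rule smooth_on_has_derivative[OF assms(3) open_coords_image[OF assms(1,4)]])
      (use assms(2,5) in auto)
  then have "((F \<circ> chart_inv c) \<circ> (coords c \<circ> C) has_derivative ?L \<circ> (\<lambda>h. h *\<^sub>R vel t c)) (at t within I)"
    using smooth_on_has_dt[OF assms(1,2) smooth_on_coords_curve[OF assms(1)]]
    by (intro diff_chain_within) (auto simp: has_vector_derivative_def velocity_chart[OF c] intro: has_derivative_at_withinI)
  then have "((\<lambda>s. F (chart_inv c (coords c (C s)))) has_vector_derivative ?L (vel t c)) (at t within I)"
    using linear_scale[OF has_derivative_linear[OF L]] by (simp add: has_vector_derivative_def comp_def)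
  then show ?thesis
    by (rule has_vector_derivative_local[OF assms(1,2), rotated]) (use assms(1) in auto)
qed

lemma pullback_smooth:
  assumes "c \<in> A" "smooth_on (coords c ` dom_chart c) (F \<circ> chart_inv c)"
  shows "smooth_on (times_in c) (\<lambda>t. F (C t))"
proof -
  have "(coords c \<circ> C) ` times_in c \<subseteq> coords c ` dom_chart c" by auto
  from smooth_on_compose[OF thick_times_in[OF assms(1)] smooth_on_coords_curve[OF assms(1)] assms(2) this]
  have "smooth_on (times_in c) (\<lambda>x. (F \<circ> chart_inv c) ((coords c \<circ> C) x))" .
  then show ?thesis by (rule smooth_on_transform) (use assms(1) in simp)
qed

lemma velocity_tangent:
  assumes "t \<in> I" shows "vel t \<in> tangent_space A (C t)"
proof (rule tangent_spaceI)
  fix c d assume c: "c \<in> charts_at A (C t)" and d: "d \<in> charts_at A (C t)"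
  note cA = charts_atD[OF c] and dA = charts_atD[OF d]
  have "smooth_on (coords c ` (dom_chart d \<inter> dom_chart c)) (coords d \<circ> chart_inv c)"
    using smooth_transition[OF cA(1) dA(1)] by (simp add: transition_def Int_commute)
  from pullback_has_dt[OF cA(1) _ this openin_dom_chart[OF dA(1)] dA(2)]
  have "((\<lambda>s. coords d (C s)) has_vector_derivative jac c d (C t) (vel t c)) (at t within I)"
    using cA(2) assms by (simp add: transition_def)
  from dt_eq[OF this assms] show "vel t d = jac c d (C t) (vel t c)"
    by (simp add: velocity_chart[OF d] comp_def)
qed (simp add: velocity_def)

lemma velocity_field_along: "field_along A I C vel"
  unfolding field_along_def
proof (intro conjI ballI velocity_tangent)
  fix c assume c: "c \<in> A"
  show "smooth_on (times_in c) (\<lambda>t. vel t c)"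
    by (rule smooth_on_transform[OF smooth_on_dt[OF c smooth_on_coords_curve[OF c]]])
      (use c in \<open>simp add: velocity_chart charts_at_def\<close>)
qed

lemma field_along_tangent: "\<lbrakk>field_along A I C V; t \<in> I\<rbrakk> \<Longrightarrow> V t \<in> tangent_space A (C t)"
  by (simp add: field_along_def)

lemma field_along_component:
  assumes "field_along A I C V" "c \<in> A" shows "smooth_on (times_in c) (\<lambda>t. V t c $ j)"
  by (rule smooth_on_bounded_linear[OF thick_times_in[OF assms(2)] bounded_linear_vec_nth])
    (use assms in \<open>simp add: field_along_def\<close>)

text \<open>
  Smoothness is required chart by chart, to match \<open>field_along\<close> without a gluing argument.
\<close>

definition smooth_along :: "(real \<Rightarrow> real) \<Rightarrow> bool" where
  "smooth_along f \<longleftrightarrow> (\<forall>c\<in>A. smooth_on (times_in c) f)"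

lemma smooth_along_dt: "smooth_along f \<Longrightarrow> smooth_along (dt f)"
  by (simp add: smooth_along_def smooth_on_dt)

lemma smooth_along_mult: "\<lbrakk>smooth_along f; smooth_along h\<rbrakk> \<Longrightarrow> smooth_along (\<lambda>t. f t * h t)"
  using smooth_on_scaleR[of _ f h] by (simp add: smooth_along_def thick_times_in)

lemma smooth_along_const: "smooth_along (\<lambda>t. a)"
  by (simp add: smooth_along_def smooth_on_const thick_times_in)

lemma smooth_along_inverse: "\<lbrakk>smooth_along f; \<And>t. t \<in> I \<Longrightarrow> f t \<noteq> 0\<rbrakk> \<Longrightarrow> smooth_along (\<lambda>t. inverse (f t))"
  unfolding smooth_along_def by (auto intro!: smooth_on_inverse thick_times_in)

lemma smooth_along_has_dt:
  assumes "smooth_along f" "t \<in> I" shows "(f has_vector_derivative dt f t) (at t within I)"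
  using smooth_on_has_dt[of "some_chart A (C t)" t f] some_chart[OF curve_in_topspace[OF assms(2)]] assms
  by (simp add: charts_at_def smooth_along_def)

lemma field_along_add:
  "\<lbrakk>field_along A I C V; field_along A I C W\<rbrakk> \<Longrightarrow> field_along A I C (\<lambda>t. V t + W t)"
  by (auto simp: field_along_def intro!: tangent_add smooth_on_add thick_times_in)

lemma field_along_scaleR:
  "\<lbrakk>smooth_along f; field_along A I C V\<rbrakk> \<Longrightarrow> field_along A I C (\<lambda>t. f t *\<^sub>R V t)"
  by (auto simp: field_along_def smooth_along_def intro!: tangent_scaleR smooth_on_scaleR thick_times_in)

lemma field_along_restrict:
  assumes "vector_field A (topspace T) X" shows "field_along A I C (\<lambda>t. X (C t))"
  unfolding field_along_def
proof (intro conjI ballI)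
  fix c assume c: "c \<in> A"
  have "topspace T \<inter> dom_chart c = dom_chart c"
    using openin_subset[OF openin_dom_chart[OF c]] by blast
  then show "smooth_on (times_in c) (\<lambda>t. X (C t) c)"
    using assms c by (intro pullback_smooth[where F = "\<lambda>p. X p c"]) (auto simp: vector_field_def comp_def)
qed (use assms curve_in_topspace in \<open>auto simp: vector_field_def\<close>)

abbreviation chart_at :: "real \<Rightarrow> 'm chart" where
  "chart_at t \<equiv> some_chart A (C t)"

lemma chart_at:
  assumes "t \<in> I"
  shows "chart_at t \<in> charts_at A (C t)" "chart_at t \<in> A" "C t \<in> dom_chart (chart_at t)" "t \<in> times_in (chart_at t)"
  using some_chart[OF curve_in_topspace[OF assms]] assms by (auto simp: charts_at_def)

text \<open>
  The coordinate fields along the curve exist only while it stays in the chart, so they are not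
  fields along all of \<open>C\<close> in the sense of \<open>field_along\<close>.  The rules for \<open>cov\<close> are therefore stated
  under this pointwise condition, which refers to the chart that \<open>cov_deriv_along\<close> uses.
\<close>

definition differentiable_along :: "(real \<Rightarrow> 'm tvec) \<Rightarrow> real \<Rightarrow> bool" where
  "differentiable_along V t \<longleftrightarrow> V t \<in> tangent_space A (C t) \<and>
     (\<forall>j. ((\<lambda>s. V s (chart_at t) $ j) has_vector_derivative dt (\<lambda>s. V s (chart_at t) $ j) t) (at t within I))"

lemma differentiable_alongI:
  assumes "t \<in> I" "V t \<in> tangent_space A (C t)"
    "\<And>j. ((\<lambda>s. V s (chart_at t) $ j) has_vector_derivative y j) (at t within I)"
  shows "differentiable_along V t"
  unfolding differentiable_along_def using assms dt_eq[OF assms(3,1)] by simp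

lemma field_along_differentiable:
  assumes "field_along A I C V" "t \<in> I" shows "differentiable_along V t"
  unfolding differentiable_along_def
  using assms chart_at[OF assms(2)] by (auto intro!: field_along_tangent smooth_on_has_dt[of "chart_at t"] field_along_component)

lemma cov_cong:
  assumes "t \<in> I" "\<And>s. s \<in> times_in (chart_at t) \<Longrightarrow> V s = W s"
  shows "cov V t = cov W t"
proof -
  have "dt (\<lambda>s. V s (chart_at t) $ j) t = dt (\<lambda>s. W s (chart_at t) $ j) t" for j
    by (rule dt_local[OF chart_at(2,4)[OF assms(1)]]) (simp add: assms(2))
  moreover have "V t = W t" using assms(2) chart_at(4)[OF assms(1)] by blast
  ultimately show ?thesis by (simp add: cov_deriv_along_def Let_def)
qed

lemma
  assumes U: "openin T U" and p: "p \<in> U" and v: "v \<in> tangent_space A p"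
  shows connection_tangent: "vector_field A U Y \<Longrightarrow> D p v Y \<in> tangent_space A p"
    and connection_add: "\<lbrakk>vector_field A U Y; vector_field A U Z\<rbrakk> \<Longrightarrow>
      D p v (\<lambda>q. Y q + Z q) = D p v Y + D p v Z"
    and connection_scaleR: "\<lbrakk>smooth_function A U f; vector_field A U Y\<rbrakk> \<Longrightarrow>
      D p v (\<lambda>q. f q *\<^sub>R Y q) = dir_deriv A p v f *\<^sub>R Y p + f p *\<^sub>R D p v Y"
    and connection_local: "\<lbrakk>vector_field A U Y; vector_field A U Z; \<And>q. q \<in> U \<Longrightarrow> Y q = Z q\<rbrakk> \<Longrightarrow>
      D p v Y = D p v Z"
proof -
  note rules = affine_connection[unfolded affine_connection_def, THEN spec, THEN mp, OF U, THEN conjunct2,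
      THEN bspec, OF p, THEN bspec, OF v]
  show "vector_field A U Y \<Longrightarrow> D p v Y \<in> tangent_space A p"
    using rules[THEN conjunct1] by simp
  note rules = rules[THEN conjunct2, THEN conjunct2]
  show "\<lbrakk>vector_field A U Y; vector_field A U Z\<rbrakk> \<Longrightarrow> D p v (\<lambda>q. Y q + Z q) = D p v Y + D p v Z"
    using rules[THEN conjunct1] by simp
  note rules = rules[THEN conjunct2]
  show "\<lbrakk>smooth_function A U f; vector_field A U Y\<rbrakk> \<Longrightarrow>
      D p v (\<lambda>q. f q *\<^sub>R Y q) = dir_deriv A p v f *\<^sub>R Y p + f p *\<^sub>R D p v Y"
    using rules[THEN conjunct1] by simp
  show "\<lbrakk>vector_field A U Y; vector_field A U Z; \<And>q. q \<in> U \<Longrightarrow> Y q = Z q\<rbrakk> \<Longrightarrow> D p v Y = D p v Z"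
    using rules[THEN conjunct2, THEN spec, of Y, THEN spec, of Z] by simp
qed

lemma connection_coord_field_tangent:
  "t \<in> I \<Longrightarrow> D (C t) (vel t) (coord_field A (chart_at t) j) \<in> tangent_space A (C t)"
  using chart_at[of t]
  by (intro connection_tangent[OF openin_dom_chart _ _ vector_field_coord_field] velocity_tangent) auto

lemma cov_tangent: "t \<in> I \<Longrightarrow> cov V t \<in> tangent_space A (C t)"
  unfolding cov_deriv_along_def Let_def
  by (intro tangent_closed coord_field_tangent connection_coord_field_tangent chart_at)

lemma cov_zero: "t \<in> I \<Longrightarrow> cov (\<lambda>s. 0) t = 0"
  using dt_eq[of "\<lambda>s. 0 :: real" 0 t] by (simp add: cov_deriv_along_def Let_def)

lemma differentiable_along_add:
  assumes "t \<in> I" "differentiable_along V t" "differentiable_along W t"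
  shows "differentiable_along (\<lambda>s. V s + W s) t"
  by (rule differentiable_alongI[OF assms(1)])
    (use assms in \<open>auto simp: differentiable_along_def intro: tangent_add has_vector_derivative_add\<close>)

lemma cov_add:
  assumes "t \<in> I" "differentiable_along V t" "differentiable_along W t"
  shows "cov (\<lambda>s. V s + W s) t = cov V t + cov W t"
proof -
  have "dt (\<lambda>s. V s (chart_at t) $ j + W s (chart_at t) $ j) t =
      dt (\<lambda>s. V s (chart_at t) $ j) t + dt (\<lambda>s. W s (chart_at t) $ j) t" for j
    using assms by (intro dt_eq has_vector_derivative_add) (auto simp: differentiable_along_def)
  then show ?thesis
    by (simp add: cov_deriv_along_def Let_def sum.distrib[symmetric] scaleR_add_left algebra_simps)
qed

lemma differentiable_along_scaleR:
  assumes "t \<in> I" "(f has_vector_derivative y) (at t within I)" "differentiable_along V t"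
  shows "differentiable_along (\<lambda>s. f s *\<^sub>R V s) t"
proof (rule differentiable_alongI[OF assms(1)])
  show "((\<lambda>s. (f s *\<^sub>R V s) (chart_at t) $ j) has_vector_derivative
      (f t * dt (\<lambda>s. V s (chart_at t) $ j) t + y * V t (chart_at t) $ j)) (at t within I)" for j
    using has_vector_derivative_mult[OF assms(2), of "\<lambda>s. V s (chart_at t) $ j"] assms(3)
    by (simp add: differentiable_along_def)
qed (use assms in \<open>simp add: differentiable_along_def tangent_scaleR\<close>)

text \<open>
  The derivative \<open>y\<close> of the factor multiplies all components of \<open>V\<close>, and the components of \<open>V t\<close> times
  the coordinate fields add up to \<open>V t\<close>.
\<close>

lemma cov_scaleR:
  assumes "t \<in> I" "(f has_vector_derivative y) (at t within I)" "differentiable_along V t"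
  shows "cov (\<lambda>s. f s *\<^sub>R V s) t = y *\<^sub>R V t + f t *\<^sub>R cov V t"
proof -
  let ?c = "chart_at t"
  have "dt (\<lambda>s. f s * V s ?c $ j) t = f t * dt (\<lambda>s. V s ?c $ j) t + y * V t ?c $ j" for j
    using assms by (intro dt_eq has_vector_derivative_mult) (auto simp: differentiable_along_def)
  then have "cov (\<lambda>s. f s *\<^sub>R V s) t = y *\<^sub>R (\<Sum>j\<in>UNIV. V t ?c $ j *\<^sub>R coord_field A ?c j (C t)) + f t *\<^sub>R cov V t"
    by (simp add: cov_deriv_along_def Let_def scaleR_sum_right sum.distrib[symmetric] algebra_simps)
  then show ?thesis
    using tangent_expand[of "V t" "C t" ?c] chart_at(1)[OF assms(1)] assms(3)
    by (simp add: differentiable_along_def)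
qed

lemma differentiable_along_zero: "t \<in> I \<Longrightarrow> differentiable_along (\<lambda>s. 0) t"
  by (rule differentiable_alongI[where y = "\<lambda>j. 0"]) (auto simp: tangent_zero)

lemma cov_sum:
  assumes t: "t \<in> I" and "\<And>j. j \<in> J \<Longrightarrow> differentiable_along (V j) t"
  shows "cov (\<lambda>s. \<Sum>j\<in>J. V j s) t = (\<Sum>j\<in>J. cov (V j) t)"
proof -
  have "differentiable_along (\<lambda>s. \<Sum>j\<in>J. V j s) t \<and> cov (\<lambda>s. \<Sum>j\<in>J. V j s) t = (\<Sum>j\<in>J. cov (V j) t)"
    using assms(2)
  proof (induction J rule: infinite_finite_induct)
    case (insert j J)
    have V: "differentiable_along (V j) t" "differentiable_along (\<lambda>s. \<Sum>i\<in>J. V i s) t"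
      "cov (\<lambda>s. \<Sum>i\<in>J. V i s) t = (\<Sum>i\<in>J. cov (V i) t)"
      using insert.IH insert.prems by auto
    show ?case
      unfolding sum.insert[OF insert.hyps] cov_add[OF t V(1,2)] V(3)
      using differentiable_along_add[OF t V(1,2)] by (rule conjI[OF _ refl])
  qed (simp_all only: sum.infinite sum.empty cov_zero[OF t] differentiable_along_zero[OF t] simp_thms)
  then show ?thesis by (rule conjunct2)
qed

lemma differentiable_along_restrict:
  assumes "t \<in> I" "openin T U" "vector_field A U X" "C t \<in> U"
  shows "differentiable_along (\<lambda>s. X (C s)) t"
proof (rule differentiable_alongI[OF assms(1)])
  let ?c = "chart_at t"
  note c = chart_at[OF assms(1)]
  fix j
  have "smooth_on (coords ?c ` (U \<inter> dom_chart ?c)) (\<lambda>x. X (chart_inv ?c x) ?c $ j)"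
    by (rule smooth_on_bounded_linear[OF thick_coords_image[OF c(2) assms(2)] bounded_linear_vec_nth])
      (use assms c in \<open>simp add: vector_field_def\<close>)
  then show "((\<lambda>s. X (C s) ?c $ j) has_vector_derivative
      frechet_derivative ((\<lambda>p. X p ?c $ j) \<circ> chart_inv ?c) (at (coords ?c (C t))) (vel t ?c)) (at t within I)"
    by (intro pullback_has_dt[OF c(2,4) _ assms(2,4)]) (simp add: comp_def)
qed (use assms in \<open>auto simp: vector_field_def\<close>)

lemma dir_deriv_velocity:
  assumes "t \<in> I" "openin T U" "smooth_function A U f" "C t \<in> U"
  shows "((\<lambda>s. f (C s)) has_vector_derivative dir_deriv A (C t) (vel t) f) (at t within I)"
  using pullback_has_dt[OF chart_at(2,4)[OF assms(1)] _ assms(2,4), of f] assms(3) chart_at(2)[OF assms(1)]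
  by (simp add: smooth_function_def dir_deriv_def Let_def)

text \<open>
  Along the curve, a vector field on an open set is differentiated by the connection itself.  On
  the chart domain \<open>X\<close> is the sum of its components times the coordinate fields; additivity and the
  Leibniz rule of \<open>D\<close> turn this into the defining formula of \<open>cov\<close>, because the directional derivative
  of a component is its derivative along the curve (\<open>dir_deriv_velocity\<close>).
\<close>

lemma cov_restrict:
  assumes "t \<in> I" "openin T U" "vector_field A U X" "C t \<in> U"
  shows "cov (\<lambda>s. X (C s)) t = D (C t) (vel t) X"
proof -
  let ?c = "chart_at t" and ?p = "C t" and ?v = "vel t"
  note c = chart_at[OF assms(1)]
  let ?U = "U \<inter> dom_chart ?c"
  let ?x = "\<lambda>j q. X q ?c $ j" and ?e = "coord_field A ?c"
  have U: "openin T ?U" using assms(2) openin_dom_chart[OF c(2)] by blast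
  have p: "?p \<in> ?U" using assms c by blast
  have v: "?v \<in> tangent_space A ?p" using velocity_tangent[OF assms(1)] .
  have X: "vector_field A ?U X" using vector_field_subset[OF assms(3,2) U] by blast
  have x: "smooth_function A ?U (?x j)" for j
    using smooth_function_component[OF X U c(2)] by blast
  have e: "vector_field A ?U (?e j)" for j
    using vector_field_subset[OF vector_field_coord_field[OF c(2)] openin_dom_chart[OF c(2)] U] by blast
  have xe: "vector_field A ?U (\<lambda>q. ?x j q *\<^sub>R ?e j q)" for j
    using vector_field_scaleR[OF U x e] .
  have xe2: "vector_field A ?U (\<lambda>q. ?x i q *\<^sub>R ?e i q + ?x j q *\<^sub>R ?e j q)" for i j
    using vector_field_add[OF U xe xe] .
  \<comment> \<open>The three summands are written out because additivity is available for two fields at a time.\<close>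
  have "D ?p ?v X = D ?p ?v (\<lambda>q. ?x 1 q *\<^sub>R ?e 1 q + ?x 2 q *\<^sub>R ?e 2 q + ?x 3 q *\<^sub>R ?e 3 q)"
  proof (rule connection_local[OF U p v X vector_field_add[OF U xe2 xe]])
    fix q assume "q \<in> ?U"
    then show "X q = ?x 1 q *\<^sub>R ?e 1 q + ?x 2 q *\<^sub>R ?e 2 q + ?x 3 q *\<^sub>R ?e 3 q"
      using tangent_expand[of "X q" q ?c] assms(3) c(2) by (simp add: sum_3 charts_at_def vector_field_def)
  qed
  also have "\<dots> = (\<Sum>j\<in>UNIV. dir_deriv A ?p ?v (?x j) *\<^sub>R ?e j ?p + ?x j ?p *\<^sub>R D ?p ?v (?e j))"
    by (simp add: sum_3 connection_add[OF U p v xe2 xe] connection_add[OF U p v xe xe] connection_scaleR[OF U p v x e])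
  also have "\<dots> = cov (\<lambda>s. X (C s)) t"
    using dt_eq[OF dir_deriv_velocity[OF assms(1) U x p] assms(1)]
    by (simp add: cov_deriv_along_def Let_def)
  finally show ?thesis by simp
qed

end

section \<open>Product rules for the metric and the structure tensors\<close>

locale sasaki_like_curve =
  fixes T :: "'m topology" and A :: "'m chart set"
    and \<phi> :: "'m \<Rightarrow> 'm tvec \<Rightarrow> 'm tvec" and \<xi> :: "'m \<Rightarrow> 'm tvec" and \<eta> :: "'m \<Rightarrow> 'm tvec \<Rightarrow> real"
    and g :: "'m \<Rightarrow> 'm tvec \<Rightarrow> 'm tvec \<Rightarrow> real" and D :: "'m connection"
    and I :: "real set" and C :: "real \<Rightarrow> 'm"
  assumes almost_contact: "almost_contact_B_metric_3_manifold T A \<phi> \<xi> \<eta> g"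
    and levi_civita: "levi_civita_connection T A g D"
    and sasaki_like: "sasaki_like T A \<phi> \<xi> \<eta> g D"
    and smooth_curve: "smooth_curve T A I C"

sublocale sasaki_like_curve \<subseteq> curve_with_connection T A D I C
  using almost_contact levi_civita smooth_curve
  by unfold_locales (auto simp: almost_contact_B_metric_3_manifold_def levi_civita_connection_def)

context sasaki_like_curve
begin

lemma
  assumes p: "p \<in> topspace T"
  shows phi_tangent: "v \<in> tangent_space A p \<Longrightarrow> \<phi> p v \<in> tangent_space A p"
    and phi_linear: "\<lbrakk>v \<in> tangent_space A p; w \<in> tangent_space A p\<rbrakk> \<Longrightarrow>
      \<phi> p (a *\<^sub>R v + b *\<^sub>R w) = a *\<^sub>R \<phi> p v + b *\<^sub>R \<phi> p w"
    and xi_tangent: "\<xi> p \<in> tangent_space A p"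
    and eta_xi: "\<eta> p (\<xi> p) = 1"
    and phi_phi: "v \<in> tangent_space A p \<Longrightarrow> \<phi> p (\<phi> p v) = - v + \<eta> p v *\<^sub>R \<xi> p"
    and metric_phi_phi: "\<lbrakk>v \<in> tangent_space A p; w \<in> tangent_space A p\<rbrakk> \<Longrightarrow>
      g p (\<phi> p v) (\<phi> p w) = - g p v w + \<eta> p v * \<eta> p w"
    and metric_linear: "\<lbrakk>u \<in> tangent_space A p; v \<in> tangent_space A p; w \<in> tangent_space A p\<rbrakk> \<Longrightarrow>
      g p (a *\<^sub>R u + b *\<^sub>R v) w = a * g p u w + b * g p v w"
    and metric_sym: "\<lbrakk>v \<in> tangent_space A p; w \<in> tangent_space A p\<rbrakk> \<Longrightarrow> g p v w = g p w v"
    and metric_nondegenerate: "\<lbrakk>v \<in> tangent_space A p; \<And>w. w \<in> tangent_space A p \<Longrightarrow> g p v w = 0\<rbrakk> \<Longrightarrow> v = 0"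
proof -
  have E: "endomorphism_field T A \<phi>" and M: "pseudo_riemannian_metric T A g"
    and X: "vector_field A (topspace T) \<xi>"
    and P: "\<eta> p (\<xi> p) = 1 \<and>
        (\<forall>X\<in>tangent_space A p. \<phi> p (\<phi> p X) = - X + \<eta> p X *\<^sub>R \<xi> p) \<and>
        (\<forall>X\<in>tangent_space A p. \<forall>Y\<in>tangent_space A p.
           g p (\<phi> p X) (\<phi> p Y) = - g p X Y + \<eta> p X * \<eta> p Y)"
    using almost_contact p by (simp_all add: almost_contact_B_metric_3_manifold_def)
  show "\<xi> p \<in> tangent_space A p" using X p by (simp add: vector_field_def)
  show "\<eta> p (\<xi> p) = 1" "v \<in> tangent_space A p \<Longrightarrow> \<phi> p (\<phi> p v) = - v + \<eta> p v *\<^sub>R \<xi> p"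
    "\<lbrakk>v \<in> tangent_space A p; w \<in> tangent_space A p\<rbrakk> \<Longrightarrow>
      g p (\<phi> p v) (\<phi> p w) = - g p v w + \<eta> p v * \<eta> p w"
    using P by simp_all
  note E = E[unfolded endomorphism_field_def]
  show "v \<in> tangent_space A p \<Longrightarrow> \<phi> p v \<in> tangent_space A p"
    using E[THEN conjunct1, THEN bspec, OF p] by simp
  show "\<lbrakk>v \<in> tangent_space A p; w \<in> tangent_space A p\<rbrakk> \<Longrightarrow>
      \<phi> p (a *\<^sub>R v + b *\<^sub>R w) = a *\<^sub>R \<phi> p v + b *\<^sub>R \<phi> p w"
    using E[THEN conjunct2, THEN conjunct1, THEN bspec, OF p] by simp
  note M = M[unfolded pseudo_riemannian_metric_def]
  show "\<lbrakk>u \<in> tangent_space A p; v \<in> tangent_space A p; w \<in> tangent_space A p\<rbrakk> \<Longrightarrow>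
      g p (a *\<^sub>R u + b *\<^sub>R v) w = a * g p u w + b * g p v w"
    using M[THEN conjunct1, THEN bspec, OF p] by simp
  show "\<lbrakk>v \<in> tangent_space A p; w \<in> tangent_space A p\<rbrakk> \<Longrightarrow> g p v w = g p w v"
    using M[THEN conjunct2, THEN conjunct1, THEN bspec, OF p] by simp
  show "\<lbrakk>v \<in> tangent_space A p; \<And>w. w \<in> tangent_space A p \<Longrightarrow> g p v w = 0\<rbrakk> \<Longrightarrow> v = 0"
    using M[THEN conjunct2, THEN conjunct2, THEN conjunct1, THEN bspec, OF p] by simp
qed

lemma xi_field: "vector_field A (topspace T) \<xi>"
  using almost_contact by (simp add: almost_contact_B_metric_3_manifold_def)

lemma phi_field: "\<lbrakk>openin T U; vector_field A U X\<rbrakk> \<Longrightarrow> vector_field A U (\<lambda>p. \<phi> p (X p))"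
  using almost_contact by (simp add: almost_contact_B_metric_3_manifold_def endomorphism_field_def)

lemma metric_field: "\<lbrakk>openin T U; vector_field A U X; vector_field A U Y\<rbrakk> \<Longrightarrow>
    smooth_function A U (\<lambda>p. g p (X p) (Y p))"
  using almost_contact by (simp add: almost_contact_B_metric_3_manifold_def pseudo_riemannian_metric_def)

lemma metric_compatible:
  "\<lbrakk>openin T U; vector_field A U Y; vector_field A U Z; p \<in> U; v \<in> tangent_space A p\<rbrakk> \<Longrightarrow>
     dir_deriv A p v (\<lambda>q. g q (Y q) (Z q)) = g p (D p v Y) (Z p) + g p (Y p) (D p v Z)"
  using levi_civita by (simp add: levi_civita_connection_def metric_connection_def)

lemma sasaki_like_rule:
  assumes "openin T U" "vector_field A U Y" "p \<in> U" "v \<in> tangent_space A p"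
  shows "D p v (\<lambda>q. \<phi> q (Y q)) = \<phi> p (D p v Y) - g p v (Y p) *\<^sub>R \<xi> p - \<eta> p (Y p) *\<^sub>R v
    + (2 * \<eta> p v * \<eta> p (Y p)) *\<^sub>R \<xi> p"
proof -
  have "D p v (\<lambda>q. \<phi> q (Y q)) - \<phi> p (D p v Y) =
          - g p v (Y p) *\<^sub>R \<xi> p - \<eta> p (Y p) *\<^sub>R v + (2 * \<eta> p v * \<eta> p (Y p)) *\<^sub>R \<xi> p"
    using sasaki_like assms by (simp add: sasaki_like_def)
  then show ?thesis by (simp add: algebra_simps)
qed

lemma
  assumes p: "p \<in> topspace T" and v: "v \<in> tangent_space A p" and w: "w \<in> tangent_space A p"
  shows phi_add: "\<phi> p (v + w) = \<phi> p v + \<phi> p w"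
    and phi_scaleR: "\<phi> p (a *\<^sub>R v) = a *\<^sub>R \<phi> p v"
    and metric_scaleR_left: "g p (a *\<^sub>R v) w = a * g p v w"
    and metric_scaleR_right: "g p v (a *\<^sub>R w) = a * g p v w"
  using phi_linear[OF p v w, of 1 1] phi_linear[OF p v v, of a 0] metric_linear[OF p v v w, of a 0]
    metric_linear[OF p w w v, of a 0] metric_sym[OF p v] metric_sym[OF p v w] w tangent_scaleR[OF w]
  by simp_all

lemma
  assumes p: "p \<in> topspace T" and "u \<in> tangent_space A p" "v \<in> tangent_space A p" "w \<in> tangent_space A p"
  shows metric_add_left: "g p (u + v) w = g p u w + g p v w"
    and metric_add_right: "g p w (u + v) = g p w u + g p w v"
  using metric_linear[OF assms, of 1 1] assms metric_sym[OF p, of w] tangent_add[of u p v]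
  by simp_all

lemma phi_zero: "p \<in> topspace T \<Longrightarrow> \<phi> p 0 = 0"
  using phi_scaleR[OF _ tangent_zero tangent_zero, of p 0] by simp

lemma metric_zero:
  assumes "p \<in> topspace T" "w \<in> tangent_space A p" shows "g p 0 w = 0" "g p w 0 = 0"
  using metric_scaleR_left[OF assms(1) tangent_zero assms(2), of 0]
    metric_scaleR_right[OF assms(1) assms(2) tangent_zero, of 0] by simp_all

lemma phi_sum:
  assumes "p \<in> topspace T" "\<And>i. i \<in> J \<Longrightarrow> v i \<in> tangent_space A p"
  shows "\<phi> p (\<Sum>i\<in>J. v i) = (\<Sum>i\<in>J. \<phi> p (v i))"
  using assms(2) 
proof (induction J rule: infinite_finite_induct)
  case (insert j J)
  have "v j \<in> tangent_space A p" "sum v J \<in> tangent_space A p"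
    using insert.prems by (auto intro: tangent_sum)
  note add = phi_add[OF assms(1) this]
  have "\<phi> p (sum v J) = (\<Sum>i\<in>J. \<phi> p (v i))" using insert.IH insert.prems by blast
  then show ?case by (simp only: sum.insert[OF insert.hyps] add)
qed (simp_all add: phi_zero assms(1))

lemma metric_sum_left:
  assumes "p \<in> topspace T" "\<And>i. i \<in> J \<Longrightarrow> v i \<in> tangent_space A p" "w \<in> tangent_space A p"
  shows "g p (\<Sum>i\<in>J. v i) w = (\<Sum>i\<in>J. g p (v i) w)"
  using assms(2) 
proof (induction J rule: infinite_finite_induct)
  case (insert j J)
  have "v j \<in> tangent_space A p" "sum v J \<in> tangent_space A p"
    using insert.prems by (auto intro: tangent_sum)
  note add = metric_add_left[OF assms(1) this assms(3)]
  have "g p (sum v J) w = (\<Sum>i\<in>J. g p (v i) w)" using insert.IH insert.prems by blast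
  then show ?case by (simp only: sum.insert[OF insert.hyps] add)
qed (simp_all add: metric_zero[OF assms(1,3)])

lemma metric_sum_right:
  assumes "p \<in> topspace T" "\<And>i. i \<in> J \<Longrightarrow> v i \<in> tangent_space A p" "w \<in> tangent_space A p"
  shows "g p w (\<Sum>i\<in>J. v i) = (\<Sum>i\<in>J. g p w (v i))"
proof -
  have "g p w (\<Sum>i\<in>J. v i) = g p (\<Sum>i\<in>J. v i) w"
    by (rule metric_sym[OF assms(1,3)]) (intro tangent_sum assms(2))
  also have "\<dots> = (\<Sum>i\<in>J. g p w (v i))"
    using assms by (simp add: metric_sum_left metric_sym[OF assms(1,3)])
  finally show ?thesis .
qed

text \<open>
  Since \<open>\<phi>\<^sup>2 \<xi> = -\<xi> + \<xi> = 0\<close>, applying \<open>\<phi>\<^sup>2\<close> to \<open>\<phi> \<xi>\<close> shows that \<open>\<phi> \<xi>\<close> is a multiple \<open>a \<xi>\<close> of \<open>\<xi>\<close>.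
  Then \<open>0 = \<phi>\<^sup>2 \<xi> = a (\<phi> \<xi>)\<close>, and both alternatives give \<open>\<phi> \<xi> = 0\<close>.
\<close>

lemma phi_xi:
  assumes p: "p \<in> topspace T" shows "\<phi> p (\<xi> p) = 0"
proof -
  let ?z = "\<phi> p (\<xi> p)"
  note t = xi_tangent[OF p] phi_tangent[OF p xi_tangent[OF p]]
  have 1: "\<phi> p ?z = 0" using phi_phi[OF p t(1)] eta_xi[OF p] by simp
  have z: "?z = \<eta> p ?z *\<^sub>R \<xi> p"
    using phi_phi[OF p t(2)] phi_zero[OF p] 1 by (simp add: eq_neg_iff_add_eq_0[symmetric] add.commute)
  then have "\<phi> p ?z = \<eta> p ?z *\<^sub>R ?z" using phi_scaleR[OF p t(1) t(1)] by metis
  with 1 have "\<eta> p ?z = 0 \<or> ?z = 0" by simp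
  then show ?thesis using z by auto
qed

lemma eta_metric:
  assumes p: "p \<in> topspace T" and v: "v \<in> tangent_space A p" shows "\<eta> p v = g p v (\<xi> p)"
  using metric_phi_phi[OF p v xi_tangent[OF p]] 
  by (simp add: phi_xi[OF p] eta_xi[OF p] metric_zero[OF p] phi_tangent[OF p] v)

text \<open>
  Both \<open>\<phi>\<^sup>2 (\<phi> v) = -\<phi> v + \<eta>(\<phi> v) \<xi>\<close> and \<open>\<phi> (\<phi>\<^sup>2 v) = -\<phi> v\<close> compute \<open>\<phi>\<^sup>3 v\<close>.
\<close>

lemma eta_phi:
  assumes p: "p \<in> topspace T" and v: "v \<in> tangent_space A p" shows "\<eta> p (\<phi> p v) = 0"
proof -
  note t = phi_tangent[OF p v] xi_tangent[OF p]
  have "\<phi> p (\<phi> p (\<phi> p v)) = \<phi> p ((-1) *\<^sub>R v + \<eta> p v *\<^sub>R \<xi> p)"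
    using phi_phi[OF p v] by simp
  also have "\<dots> = - \<phi> p v"
    using phi_linear[OF p v t(2), of "-1" "\<eta> p v"] by (simp add: phi_xi[OF p])
  finally have "\<eta> p (\<phi> p v) *\<^sub>R \<xi> p = 0" using phi_phi[OF p t(1)] by simp
  moreover have "\<xi> p \<noteq> 0"
    using eta_xi[OF p] eta_metric[OF p t(2)] metric_zero[OF p tangent_zero] by auto
  ultimately show ?thesis by simp
qed

text \<open>
  Evaluate \<open>g(\<phi>\<^sup>2 v, \<phi> w)\<close> in two ways: by the compatibility of \<open>g\<close> with \<open>\<phi>\<close>, and by the formula for
  \<open>\<phi>\<^sup>2\<close>.  The terms with \<open>\<eta>\<close> drop out because \<open>\<eta> \<circ> \<phi> = 0\<close>.
\<close>

lemma phi_self_adjoint: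
  assumes p: "p \<in> topspace T" and v: "v \<in> tangent_space A p" and w: "w \<in> tangent_space A p"
  shows "g p (\<phi> p v) w = g p v (\<phi> p w)"
proof -
  note t = phi_tangent[OF p v] phi_tangent[OF p w] xi_tangent[OF p]
  have "- g p (\<phi> p v) w = g p (\<phi> p (\<phi> p v)) (\<phi> p w)"
    using metric_phi_phi[OF p t(1) w] eta_phi[OF p v] by simp
  also have "\<dots> = g p ((-1) *\<^sub>R v + \<eta> p v *\<^sub>R \<xi> p) (\<phi> p w)"
    by (simp only: phi_phi[OF p v] scaleR_minus1_left)
  also have "\<dots> = - g p v (\<phi> p w)"
    unfolding metric_linear[OF p v t(3,2)]
    using eta_metric[OF p t(2)] eta_phi[OF p w] metric_sym[OF p t(2,3)] by simp
  finally show ?thesis by simp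
qed

lemma coord_field_at: 
  assumes "c \<in> A" "t \<in> times_in c"
  shows "coord_field A c j (C t) \<in> tangent_space A (C t)"
  using assms by (intro coord_field_tangent) (simp add: charts_at_def)

lemma field_along_expand:
  assumes "field_along A I C V" "c \<in> A" "t \<in> times_in c"
  shows "V t = (\<Sum>j\<in>UNIV. V t c $ j *\<^sub>R coord_field A c j (C t))"
  using assms by (intro tangent_expand) (auto simp: field_along_def charts_at_def)

lemma phi_expand:
  assumes "field_along A I C V" "c \<in> A" "t \<in> times_in c"
  shows "\<phi> (C t) (V t) = (\<Sum>j\<in>UNIV. V t c $ j *\<^sub>R \<phi> (C t) (coord_field A c j (C t)))"
proof -
  have p: "C t \<in> topspace T" using curve_in_topspace assms(3) by blast
  have "\<phi> (C t) (V t) = \<phi> (C t) (\<Sum>j\<in>UNIV. V t c $ j *\<^sub>R coord_field A c j (C t))"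
    using field_along_expand[OF assms] by simp
  also have "\<dots> = (\<Sum>j\<in>UNIV. V t c $ j *\<^sub>R \<phi> (C t) (coord_field A c j (C t)))"
    using coord_field_at[OF assms(2,3)] p
    by (simp add: phi_sum tangent_scaleR phi_scaleR[OF p _ tangent_zero])
  finally show ?thesis .
qed

lemma metric_expand:
  assumes "field_along A I C V" "field_along A I C W" "c \<in> A" "t \<in> times_in c"
  shows "g (C t) (V t) (W t) = (\<Sum>i\<in>UNIV. \<Sum>j\<in>UNIV. V t c $ i * (W t c $ j *
    g (C t) (coord_field A c i (C t)) (coord_field A c j (C t))))"
proof -
  have p: "C t \<in> topspace T" using curve_in_topspace assms(4) by blast
  note e = coord_field_at[OF assms(3,4)]
  have inner: "g (C t) (coord_field A c i (C t)) (W t) =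
      (\<Sum>j\<in>UNIV. W t c $ j * g (C t) (coord_field A c i (C t)) (coord_field A c j (C t)))" for i
    by (subst field_along_expand[OF assms(2-4)])
      (simp add: metric_sum_right[OF p] metric_scaleR_right[OF p] tangent_scaleR e)
  have W: "W t \<in> tangent_space A (C t)" using field_along_tangent assms(2,4) by blast
  have "g (C t) (V t) (W t) = (\<Sum>i\<in>UNIV. V t c $ i * g (C t) (coord_field A c i (C t)) (W t))"
    by (subst field_along_expand[OF assms(1,3,4)])
      (simp add: metric_sum_left[OF p] metric_scaleR_left[OF p] tangent_scaleR e W)
  then show ?thesis by (simp add: inner sum_distrib_left)
qed

text \<open>
  In a chart \<open>c\<close> the components of \<open>\<phi> V\<close> are combinations of those of \<open>V\<close>, with coefficients that are
  the components of the smooth vector fields \<open>\<phi> (coord_field A c j)\<close> along the curve.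
\<close>

lemma field_along_phi:
  assumes V: "field_along A I C V" shows "field_along A I C (\<lambda>t. \<phi> (C t) (V t))"
  unfolding field_along_def
proof (intro conjI ballI)
  fix c assume c: "c \<in> A"
  let ?F = "\<lambda>j p. \<phi> p (coord_field A c j p)"
  have "smooth_on (times_in c) (\<lambda>t. ?F j (C t) c)" for j
  proof (rule pullback_smooth[OF c])
    have "smooth_on (coords c ` (dom_chart c \<inter> dom_chart c)) (\<lambda>x. ?F j (chart_inv c x) c)"
      using phi_field[OF openin_dom_chart[OF c] vector_field_coord_field[OF c]] c
      unfolding vector_field_def by blast
    then show "smooth_on (coords c ` dom_chart c) ((\<lambda>p. ?F j p c) \<circ> chart_inv c)"
      by (simp add: comp_def)
  qed
  then have "smooth_on (times_in c) (\<lambda>t. \<Sum>j\<in>UNIV. V t c $ j *\<^sub>R ?F j (C t) c)"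
    by (intro smooth_on_sum smooth_on_scaleR thick_times_in[OF c] field_along_component[OF V c])
  then show "smooth_on (times_in c) (\<lambda>t. \<phi> (C t) (V t) c)"
    by (rule smooth_on_transform) (simp add: phi_expand[OF V c] sum_fun_apply)
qed (use V curve_in_topspace in \<open>auto intro: phi_tangent simp: field_along_def\<close>)

lemma smooth_along_metric:
  assumes V: "field_along A I C V" and W: "field_along A I C W"
  shows "smooth_along (\<lambda>t. g (C t) (V t) (W t))"
  unfolding smooth_along_def
proof
  fix c assume c: "c \<in> A"
  let ?F = "\<lambda>i j p. g p (coord_field A c i p) (coord_field A c j p)"
  have F: "smooth_on (times_in c) (\<lambda>t. ?F i j (C t))" for i j
  proof (rule pullback_smooth[OF c])
    have "smooth_on (coords c ` (dom_chart c \<inter> dom_chart c)) (?F i j \<circ> chart_inv c)"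
      using metric_field[OF openin_dom_chart[OF c] vector_field_coord_field[OF c] vector_field_coord_field[OF c]] c
      unfolding smooth_function_def by blast
    then show "smooth_on (coords c ` dom_chart c) (?F i j \<circ> chart_inv c)" by simp
  qed
  have "smooth_on (times_in c) (\<lambda>t. \<Sum>i\<in>UNIV. \<Sum>j\<in>UNIV. V t c $ i *\<^sub>R (W t c $ j *\<^sub>R ?F i j (C t)))"
    by (intro smooth_on_sum smooth_on_scaleR thick_times_in[OF c] field_along_component[OF V c]
        field_along_component[OF W c] F)
  then show "smooth_on (times_in c) (\<lambda>t. g (C t) (V t) (W t))"
    by (rule smooth_on_transform) (simp add: metric_expand[OF V W c])
qed

text \<open>
  Expand \<open>g(V, W)\<close> as a double sum over the coordinate fields \<open>e\<^sub>i\<close>.  The coefficients \<open>g(e\<^sub>i, e\<^sub>j)\<close> are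
  functions on the chart domain, and their derivative along the curve is given by the
  compatibility of the connection with the metric.
\<close>

lemma dt_metric:
  assumes V: "field_along A I C V" and W: "field_along A I C W" and t: "t \<in> I"
  shows "dt (\<lambda>s. g (C s) (V s) (W s)) t = g (C t) (cov V t) (W t) + g (C t) (V t) (cov W t)"
proof -
  let ?c = "chart_at t" and ?p = "C t"
  note c = chart_at[OF t]
  have p: "?p \<in> topspace T" using curve_in_topspace[OF t] .
  let ?e = "coord_field A ?c"
  let ?G = "\<lambda>i j q. g q (?e i q) (?e j q)" and ?De = "\<lambda>j. D ?p (vel t) (?e j)"
  let ?V = "\<lambda>i s. V s ?c $ i" and ?W = "\<lambda>j s. W s ?c $ j"
  note e = coord_field_tangent[OF c(1)] and De = connection_coord_field_tangent[OF t]
  note U = openin_dom_chart[OF c(2)] and X = vector_field_coord_field[OF c(2)]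
  have G: "((\<lambda>s. ?G i j (C s)) has_vector_derivative g ?p (?De i) (?e j ?p) + g ?p (?e i ?p) (?De j))
      (at t within I)" for i j
    using dir_deriv_velocity[OF t U metric_field[OF U X X] c(3)]
      metric_compatible[OF U X X c(3) velocity_tangent[OF t]] by simp
  have V': "(?V i has_vector_derivative dt (?V i) t) (at t within I)"
    and W': "(?W i has_vector_derivative dt (?W i) t) (at t within I)" for i
    using field_along_differentiable[OF V t] field_along_differentiable[OF W t]
    by (simp_all add: differentiable_along_def)
  have "((\<lambda>s. \<Sum>i\<in>UNIV. \<Sum>j\<in>UNIV. ?V i s * (?W j s * ?G i j (C s))) has_vector_derivative
    (\<Sum>i\<in>UNIV. \<Sum>j\<in>UNIV. ?V i t * (?W j t * (g ?p (?De i) (?e j ?p) + g ?p (?e i ?p) (?De j))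
       + dt (?W j) t * ?G i j ?p) + dt (?V i) t * (?W j t * ?G i j ?p))) (at t within I)"
    by (intro has_vector_derivative_sum has_vector_derivative_mult V' W' G)
  then have "((\<lambda>s. g (C s) (V s) (W s)) has_vector_derivative
    (\<Sum>i\<in>UNIV. \<Sum>j\<in>UNIV. ?V i t * (?W j t * (g ?p (?De i) (?e j ?p) + g ?p (?e i ?p) (?De j))
       + dt (?W j) t * ?G i j ?p) + dt (?V i) t * (?W j t * ?G i j ?p))) (at t within I)"
    by (rule has_vector_derivative_local[OF c(2,4), rotated]) (simp add: metric_expand[OF V W c(2)])
  from dt_eq[OF this t] have lhs: "dt (\<lambda>s. g (C s) (V s) (W s)) t =
    (\<Sum>i\<in>UNIV. \<Sum>j\<in>UNIV. ?V i t * (?W j t * (g ?p (?De i) (?e j ?p) + g ?p (?e i ?p) (?De j))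
       + dt (?W j) t * ?G i j ?p) + dt (?V i) t * (?W j t * ?G i j ?p))" .
  have cov: "cov X t = (\<Sum>j\<in>UNIV. dt (\<lambda>s. X s ?c $ j) t *\<^sub>R ?e j ?p + X t ?c $ j *\<^sub>R ?De j)" for X
    by (simp add: cov_deriv_along_def Let_def)
  note tangent = tangent_sum tangent_add tangent_scaleR e De
  note metric = metric_sum_left[OF p] metric_sum_right[OF p] metric_add_left[OF p] metric_add_right[OF p]
    metric_scaleR_left[OF p] metric_scaleR_right[OF p]
  have V_expand: "g ?p (V t) w = (\<Sum>i\<in>UNIV. ?V i t * g ?p (?e i ?p) w)"
    and W_expand: "g ?p w (W t) = (\<Sum>j\<in>UNIV. ?W j t * g ?p w (?e j ?p))"
    if w: "w \<in> tangent_space A ?p" for w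
    by (subst field_along_expand[OF V c(2,4)], simp add: metric tangent w)
      (subst field_along_expand[OF W c(2,4)], simp add: metric tangent w)
  have left: "g ?p (cov V t) (W t) = (\<Sum>i\<in>UNIV. \<Sum>j\<in>UNIV. dt (?V i) t * (?W j t * ?G i j ?p) +
      ?V i t * (?W j t * g ?p (?De i) (?e j ?p)))"
    by (simp add: cov metric tangent field_along_tangent[OF W t])
      (simp add: W_expand e De sum_distrib_left sum.distrib)
  have right: "g ?p (V t) (cov W t) = (\<Sum>i\<in>UNIV. \<Sum>j\<in>UNIV. ?V i t * (dt (?W j) t * ?G i j ?p) +
      ?V i t * (?W j t * g ?p (?e i ?p) (?De j)))"
    by (simp add: V_expand cov_tangent[OF t])
      (simp add: cov metric tangent sum_distrib_left sum.distrib distrib_left)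
  show ?thesis unfolding lhs left right sum.distrib[symmetric]
    by (intro sum.cong refl) (simp add: algebra_simps)
qed

text \<open>
  With \<open>V = \<Sum>\<^sub>j V\<^sub>j e\<^sub>j\<close> near \<open>t\<close>, the field \<open>\<phi> V\<close> is the combination of the vector fields \<open>\<phi> e\<^sub>j\<close> with the
  same coefficients.  The Sasaki-like condition compares \<open>\<nabla>(\<phi> e\<^sub>j)\<close> with \<open>\<phi> (\<nabla>e\<^sub>j)\<close>, and the difference
  is tensorial, so it adds up to its value on \<open>V\<close>.
\<close>

lemma cov_phi:
  assumes V: "field_along A I C V" and t: "t \<in> I"
  shows "cov (\<lambda>s. \<phi> (C s) (V s)) t = \<phi> (C t) (cov V t) - g (C t) (vel t) (V t) *\<^sub>R \<xi> (C t)
    - \<eta> (C t) (V t) *\<^sub>R vel t + (2 * \<eta> (C t) (vel t) * \<eta> (C t) (V t)) *\<^sub>R \<xi> (C t)"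
proof -
  let ?c = "chart_at t" and ?p = "C t" and ?v = "vel t"
  note c = chart_at[OF t]
  have p: "?p \<in> topspace T" using curve_in_topspace[OF t] .
  let ?e = "coord_field A ?c"
  let ?De = "\<lambda>j. D ?p ?v (?e j)" and ?F = "\<lambda>j q. \<phi> q (?e j q)" and ?V = "\<lambda>i s. V s ?c $ i"
  note e = coord_field_tangent[OF c(1)] and De = connection_coord_field_tangent[OF t]
  note U = openin_dom_chart[OF c(2)] and X = vector_field_coord_field[OF c(2)]
  note F = phi_field[OF U X] and v = velocity_tangent[OF t] and xi = xi_tangent[OF p]
  have V': "(?V i has_vector_derivative dt (?V i) t) (at t within I)" for i
    using field_along_differentiable[OF V t] by (simp add: differentiable_along_def)
  have F': "differentiable_along (\<lambda>s. ?F j (C s)) t" for j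
    using differentiable_along_restrict[OF t U F c(3)] .
  have "cov (\<lambda>s. \<phi> (C s) (V s)) t = cov (\<lambda>s. \<Sum>j\<in>UNIV. ?V j s *\<^sub>R ?F j (C s)) t"
    by (rule cov_cong[OF t]) (simp add: phi_expand[OF V c(2)])
  also have "\<dots> = (\<Sum>j\<in>UNIV. cov (\<lambda>s. ?V j s *\<^sub>R ?F j (C s)) t)"
    by (rule cov_sum[OF t differentiable_along_scaleR[OF t V' F']])
  also have "\<dots> = (\<Sum>j\<in>UNIV. dt (?V j) t *\<^sub>R ?F j ?p + ?V j t *\<^sub>R (\<phi> ?p (?De j) - g ?p ?v (?e j ?p) *\<^sub>R \<xi> ?p
      - g ?p (?e j ?p) (\<xi> ?p) *\<^sub>R ?v + (2 * \<eta> ?p ?v * g ?p (?e j ?p) (\<xi> ?p)) *\<^sub>R \<xi> ?p))"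
    by (simp only: cov_scaleR[OF t V' F'] cov_restrict[OF t U F c(3)] sasaki_like_rule[OF U X c(3) v]
        eta_metric[OF p e])
  also have "\<dots> = (\<Sum>j\<in>UNIV. dt (?V j) t *\<^sub>R ?F j ?p + ?V j t *\<^sub>R \<phi> ?p (?De j))
    - (\<Sum>j\<in>UNIV. ?V j t * g ?p ?v (?e j ?p)) *\<^sub>R \<xi> ?p - (\<Sum>j\<in>UNIV. ?V j t * g ?p (?e j ?p) (\<xi> ?p)) *\<^sub>R ?v
    + (2 * \<eta> ?p ?v * (\<Sum>j\<in>UNIV. ?V j t * g ?p (?e j ?p) (\<xi> ?p))) *\<^sub>R \<xi> ?p"
    by (simp only: scaleR_sum_left sum_distrib_left sum.distrib[symmetric] sum_subtractf[symmetric])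
      (intro sum.cong refl, simp only: scaleR_add_right scaleR_diff_right scaleR_scaleR mult_ac add_ac add_diff_eq)
  also have "(\<Sum>j\<in>UNIV. dt (?V j) t *\<^sub>R ?F j ?p + ?V j t *\<^sub>R \<phi> ?p (?De j)) = \<phi> ?p (cov V t)"
    by (simp add: cov_deriv_along_def Let_def phi_sum[OF p] phi_linear[OF p] tangent_add tangent_scaleR e De)
  also have "(\<Sum>j\<in>UNIV. ?V j t * g ?p ?v (?e j ?p)) = g ?p ?v (V t)"
    by (subst field_along_expand[OF V c(2,4)])
      (simp add: metric_sum_right[OF p] metric_scaleR_right[OF p] tangent_scaleR e v)
  also have "(\<Sum>j\<in>UNIV. ?V j t * g ?p (?e j ?p) (\<xi> ?p)) = g ?p (V t) (\<xi> ?p)"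
    by (subst field_along_expand[OF V c(2,4)])
      (simp add: metric_sum_left[OF p] metric_scaleR_left[OF p] tangent_scaleR e xi)
  finally show ?thesis
    by (simp only: eta_metric[OF p field_along_tangent[OF V t]])
qed

end

section \<open>The structure equations of a Legendre null curve\<close>

locale null_legendre_curve = sasaki_like_curve +
  assumes null: "\<And>t. t \<in> I \<Longrightarrow> g (C t) (vel t) (vel t) = 0"
    and velocity_nonzero: "\<And>t. t \<in> I \<Longrightarrow> vel t \<noteq> 0"
    and legendre: "\<And>t. t \<in> I \<Longrightarrow> \<eta> (C t) (vel t) = 0"
begin

abbreviation phi_vel :: "real \<Rightarrow> 'a tvec" where "phi_vel t \<equiv> \<phi> (C t) (vel t)"
abbreviation reeb :: "real \<Rightarrow> 'a tvec" where "reeb t \<equiv> \<xi> (C t)"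
definition b :: "real \<Rightarrow> real" where "b t = g (C t) (vel t) (phi_vel t)"

text \<open>
  Coordinates with respect to the frame \<open>C'\<close>, \<open>\<phi> C'\<close>, \<open>\<xi>\<close>.  Identities between vector fields along the
  curve become identities between three real coefficients.
\<close>

definition comb :: "real \<Rightarrow> real \<Rightarrow> real \<Rightarrow> real \<Rightarrow> 'a tvec" where
  "comb t \<alpha> \<beta> \<gamma> = \<alpha> *\<^sub>R vel t + \<beta> *\<^sub>R phi_vel t + \<gamma> *\<^sub>R reeb t"

lemma comb_add: "comb t \<alpha> \<beta> \<gamma> + comb t \<alpha>' \<beta>' \<gamma>' = comb t (\<alpha> + \<alpha>') (\<beta> + \<beta>') (\<gamma> + \<gamma>')"
  unfolding comb_def by (simp only: scaleR_add_left add_ac)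

lemma comb_scaleR: "a *\<^sub>R comb t \<alpha> \<beta> \<gamma> = comb t (a * \<alpha>) (a * \<beta>) (a * \<gamma>)"
  unfolding comb_def by (simp only: scaleR_add_right scaleR_scaleR)

lemma comb_diff: "comb t \<alpha> \<beta> \<gamma> - comb t \<alpha>' \<beta>' \<gamma>' = comb t (\<alpha> - \<alpha>') (\<beta> - \<beta>') (\<gamma> - \<gamma>')"
  using comb_add[of t "\<alpha> - \<alpha>'" "\<beta> - \<beta>'" "\<gamma> - \<gamma>'" \<alpha>' \<beta>' \<gamma>']
  by (simp only: diff_add_cancel diff_eq_eq)

lemma comb_units: "vel t = comb t 1 0 0" "phi_vel t = comb t 0 1 0" "reeb t = comb t 0 0 1"
  by (simp_all add: comb_def)

context
  fixes t assumes t: "t \<in> I"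
begin

lemma frame_tangent:
  shows "vel t \<in> tangent_space A (C t)" "phi_vel t \<in> tangent_space A (C t)" "reeb t \<in> tangent_space A (C t)"
  using velocity_tangent[OF t] curve_in_topspace[OF t] by (simp_all add: phi_tangent xi_tangent)

lemma comb_tangent: "comb t \<alpha> \<beta> \<gamma> \<in> tangent_space A (C t)"
  unfolding comb_def by (intro tangent_closed frame_tangent)

lemma phi_phi_vel: "\<phi> (C t) (phi_vel t) = - vel t"
  using phi_phi[OF curve_in_topspace[OF t] frame_tangent(1)] legendre[OF t] by simp

lemma frame_metric:
  "g (C t) (vel t) (vel t) = 0" "g (C t) (vel t) (reeb t) = 0" "g (C t) (vel t) (phi_vel t) = b t"
  "g (C t) (reeb t) (reeb t) = 1" "g (C t) (phi_vel t) (reeb t) = 0" "g (C t) (phi_vel t) (phi_vel t) = 0"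
  "g (C t) (reeb t) (vel t) = 0" "g (C t) (phi_vel t) (vel t) = b t" "g (C t) (reeb t) (phi_vel t) = 0"
proof -
  note p = curve_in_topspace[OF t]
  show 1: "g (C t) (vel t) (vel t) = 0" "g (C t) (vel t) (phi_vel t) = b t"
    by (simp_all add: null[OF t] b_def)
  show "g (C t) (phi_vel t) (phi_vel t) = 0"
    using metric_phi_phi[OF p frame_tangent(1,1)] 1 legendre[OF t] by simp
  show 2: "g (C t) (vel t) (reeb t) = 0" "g (C t) (reeb t) (reeb t) = 1" "g (C t) (phi_vel t) (reeb t) = 0"
    using eta_metric[OF p] frame_tangent legendre[OF t] eta_xi[OF p] eta_phi[OF p frame_tangent(1)]
    by metis+
  show "g (C t) (reeb t) (vel t) = 0" "g (C t) (phi_vel t) (vel t) = b t" "g (C t) (reeb t) (phi_vel t) = 0"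
    using 1 2 frame_tangent metric_sym[OF p] by metis+
qed

lemma comb_metric: "g (C t) (comb t \<alpha> \<beta> \<gamma>) (comb t \<alpha>' \<beta>' \<gamma>') = b t * (\<alpha> * \<beta>' + \<beta> * \<alpha>') + \<gamma> * \<gamma>'"
proof -
  note p = curve_in_topspace[OF t]
  show ?thesis
    unfolding comb_def
    by (simp add: metric_add_left[OF p] metric_add_right[OF p] metric_scaleR_left[OF p] metric_scaleR_right[OF p]
        tangent_add tangent_scaleR frame_tangent frame_metric algebra_simps)
qed

lemma phi_comb: "\<phi> (C t) (comb t \<alpha> \<beta> \<gamma>) = comb t (- \<beta>) \<alpha> 0"
proof -
  note p = curve_in_topspace[OF t]
  have "\<phi> (C t) (comb t \<alpha> \<beta> \<gamma>) = \<alpha> *\<^sub>R phi_vel t + \<beta> *\<^sub>R \<phi> (C t) (phi_vel t) + \<gamma> *\<^sub>R \<phi> (C t) (reeb t)"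
    unfolding comb_def
    by (simp only: phi_add[OF p] phi_scaleR[OF p _ tangent_zero] tangent_add tangent_scaleR frame_tangent)
  also have "\<dots> = comb t (- \<beta>) \<alpha> 0"
    unfolding phi_phi_vel phi_xi[OF p] comb_def
    by (simp only: scaleR_minus_right scaleR_minus_left scaleR_zero_left scaleR_zero_right add.commute)
  finally show ?thesis .
qed

text \<open>
  The product with \<open>\<xi>\<close> gives \<open>\<gamma> = 0\<close>.  On the span of \<open>C'\<close> and \<open>\<phi> C'\<close> the endomorphism \<open>\<phi>\<close> is a complex
  structure, so \<open>\<alpha> C' + \<beta> \<phi> C' = 0\<close> is multiplication of \<open>C'\<close> by the complex number \<open>\<alpha> + i \<beta>\<close>, and
  multiplying by its conjugate leaves \<open>(\<alpha>\<^sup>2 + \<beta>\<^sup>2) C' = 0\<close>.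
\<close>

lemma comb_eq_zero:
  assumes "comb t \<alpha> \<beta> \<gamma> = 0" shows "\<alpha> = 0" "\<beta> = 0" "\<gamma> = 0"
proof -
  note p = curve_in_topspace[OF t]
  have "g (C t) (comb t \<alpha> \<beta> \<gamma>) (comb t 0 0 1) = 0"
    unfolding assms using metric_zero[OF p comb_tangent] by simp
  then show \<gamma>: "\<gamma> = 0" by (simp add: comb_metric)
  have "comb t (- \<beta>) \<alpha> 0 = 0"
    using phi_comb[of \<alpha> \<beta> \<gamma>] phi_zero[OF p] assms by simp
  then have "\<alpha> *\<^sub>R comb t \<alpha> \<beta> \<gamma> - \<beta> *\<^sub>R comb t (- \<beta>) \<alpha> 0 = 0"
    using assms by simp
  then have "comb t (\<alpha> * \<alpha> + \<beta> * \<beta>) 0 0 = 0"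
    by (simp add: comb_scaleR comb_diff \<gamma> mult.commute)
  then have "(\<alpha> * \<alpha> + \<beta> * \<beta>) *\<^sub>R vel t = 0"
    unfolding comb_def by simp
  then have "\<alpha> * \<alpha> + \<beta> * \<beta> = 0"
    using velocity_nonzero[OF t] scaleR_eq_0_iff by blast
  then show "\<alpha> = 0" "\<beta> = 0" by (simp_all add: sum_squares_eq_zero_iff)
qed

text \<open>
  The coordinate map \<open>real^3 \<Rightarrow> real^3\<close> of the frame in a chart is injective, hence surjective.
\<close>

lemma comb_spans:
  assumes w: "w \<in> tangent_space A (C t)" obtains \<alpha> \<beta> \<gamma> where "w = comb t \<alpha> \<beta> \<gamma>"
proof -
  let ?c = "chart_at t"
  note c = chart_at(1)[OF t]
  let ?L = "\<lambda>x :: real^3. comb t (x $ 1) (x $ 2) (x $ 3) ?c"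
  have "linear ?L"
    by (rule linearI) (simp_all add: comb_def scaleR_add_left scaleR_add_right)
  moreover have "inj ?L"
  proof (subst linear_injective_0[OF \<open>linear ?L\<close>], intro allI impI)
    fix x assume "?L x = 0"
    then have "comb t (x $ 1) (x $ 2) (x $ 3) = 0"
      by (intro tangent_eqI[OF comb_tangent tangent_zero c]) simp
    from comb_eq_zero[OF this] show "x = 0" by (simp add: vec_eq_iff forall_3)
  qed
  ultimately have "surj ?L" by (rule linear_inj_imp_surj)
  then obtain x where "w ?c = ?L x" by (rule surjE)
  then have "w = comb t (x $ 1) (x $ 2) (x $ 3)" by (rule tangent_eqI[OF w comb_tangent c])
  then show ?thesis using that by blast
qed

lemma b_nonzero: "b t \<noteq> 0"
proof
  assume b: "b t = 0"
  have "vel t = 0"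
  proof (rule metric_nondegenerate[OF curve_in_topspace[OF t] frame_tangent(1)])
    fix w assume "w \<in> tangent_space A (C t)"
    then obtain \<alpha> \<beta> \<gamma> where "w = comb t \<alpha> \<beta> \<gamma>" by (rule comb_spans)
    then show "g (C t) (vel t) w = 0" using comb_metric[of 1 0 0 \<alpha> \<beta> \<gamma>] b by (simp add: comb_units(1)[symmetric])
  qed
  then show False using velocity_nonzero[OF t] by simp
qed

lemma tangent_comb:
  assumes w: "w \<in> tangent_space A (C t)"
  shows "w = comb t (g (C t) w (phi_vel t) / b t) (g (C t) w (vel t) / b t) (g (C t) w (reeb t))"
proof -
  obtain \<alpha> \<beta> \<gamma> where eq: "w = comb t \<alpha> \<beta> \<gamma>" using w by (rule comb_spans)
  have "g (C t) w (phi_vel t) = \<alpha> * b t" "g (C t) w (vel t) = \<beta> * b t" "g (C t) w (reeb t) = \<gamma>"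
    unfolding eq
    by (subst comb_units, subst comb_metric, simp)+
  then show ?thesis using eq b_nonzero by simp
qed

end

lemma phi_vel_field: "field_along A I C phi_vel"
  by (rule field_along_phi[OF velocity_field_along])

lemma reeb_field: "field_along A I C reeb"
  by (rule field_along_restrict[OF xi_field])

lemma smooth_along_b: "smooth_along b"
  using smooth_along_metric[OF velocity_field_along phi_vel_field] by (simp add: b_def[abs_def])

text \<open>
  The Sasaki-like condition for \<open>\<phi> \<xi> = 0\<close> reads \<open>\<phi> (\<nabla>\<xi>) = C'\<close>, which determines \<open>\<nabla>\<xi>\<close> up to a multiple
  of \<open>\<xi>\<close>.  That multiple vanishes because \<open>\<xi>\<close> has constant length.
\<close>

lemma cov_reeb: 
  assumes t: "t \<in> I" shows "cov reeb t = comb t 0 (-1) 0"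
proof -
  note p = curve_in_topspace[OF t]
  have "cov (\<lambda>s. \<phi> (C s) (reeb s)) t = cov (\<lambda>s. 0) t"
    by (rule cov_cong[OF t]) (simp add: phi_xi curve_in_topspace)
  then have "\<phi> (C t) (cov reeb t) - g (C t) (vel t) (reeb t) *\<^sub>R reeb t - \<eta> (C t) (reeb t) *\<^sub>R vel t
    + (2 * \<eta> (C t) (vel t) * \<eta> (C t) (reeb t)) *\<^sub>R reeb t = 0"
    using cov_phi[OF reeb_field t] cov_zero[OF t] by simp
  then have phi: "\<phi> (C t) (cov reeb t) = vel t"
    by (simp add: frame_metric[OF t] legendre[OF t] eta_xi[OF p])
  have "dt (\<lambda>s. g (C s) (reeb s) (reeb s)) t = dt (\<lambda>s. 1) t"
    by (rule dt_local[OF chart_at(2,4)[OF t]]) (simp add: frame_metric)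
  then have "g (C t) (cov reeb t) (reeb t) + g (C t) (reeb t) (cov reeb t) = 0"
    using dt_metric[OF reeb_field reeb_field t] dt_eq[OF has_vector_derivative_const t] by simp
  then have "g (C t) (cov reeb t) (reeb t) = 0"
    using metric_sym[OF p cov_tangent[OF t] frame_tangent(3)[OF t]] by simp
  then obtain \<alpha> \<beta> where comb: "cov reeb t = comb t \<alpha> \<beta> 0"
    using tangent_comb[OF t cov_tangent[OF t]] by metis
  have "comb t (- \<beta>) \<alpha> 0 = comb t 1 0 0"
    using phi unfolding comb phi_comb[OF t] comb_units(1)[symmetric] .
  then have "comb t (- \<beta> - 1) (\<alpha> - 0) (0 - 0) = 0" unfolding comb_diff[symmetric] by simp
  from comb_eq_zero[OF t this] show ?thesis unfolding comb by simp
qed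

text \<open>
  The products of \<open>\<nabla>C'\<close> with \<open>C'\<close>, \<open>\<xi>\<close> and \<open>\<phi> C'\<close> are read off from the derivatives of \<open>g(C', C') = 0\<close>,
  \<open>g(C', \<xi>) = 0\<close> and \<open>g(C', \<phi> C') = b\<close>.  In the last one the two terms agree, as
  \<open>\<nabla>(\<phi> C') = \<phi> (\<nabla>C')\<close> and \<open>\<phi>\<close> is self-adjoint; hence the factor 2.
\<close>

lemma cov_velocity:
  assumes t: "t \<in> I" shows "cov vel t = comb t (dt b t / (2 * b t)) 0 (b t)"
proof -
  note p = curve_in_topspace[OF t]
  note a = cov_tangent[OF t, of vel] and f = frame_tangent[OF t] and V = velocity_field_along
  have "dt (\<lambda>s. g (C s) (vel s) (vel s)) t = dt (\<lambda>s. 0) t"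
    by (rule dt_local[OF chart_at(2,4)[OF t]]) (simp add: frame_metric)
  then have "g (C t) (cov vel t) (vel t) + g (C t) (vel t) (cov vel t) = 0"
    using dt_metric[OF V V t] dt_eq[OF has_vector_derivative_const t] by simp
  then have 1: "g (C t) (cov vel t) (vel t) = 0"
    using metric_sym[OF p a f(1)] by simp
  have "dt (\<lambda>s. g (C s) (vel s) (reeb s)) t = dt (\<lambda>s. 0) t"
    by (rule dt_local[OF chart_at(2,4)[OF t]]) (simp add: frame_metric)
  then have "g (C t) (cov vel t) (reeb t) + g (C t) (vel t) (cov reeb t) = 0"
    using dt_metric[OF V reeb_field t] dt_eq[OF has_vector_derivative_const t] by simp
  moreover have "g (C t) (vel t) (cov reeb t) = - b t"
    unfolding cov_reeb[OF t] comb_units(1) by (simp add: comb_metric[OF t])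
  ultimately have 2: "g (C t) (cov vel t) (reeb t) = b t" by simp
  have "cov phi_vel t = \<phi> (C t) (cov vel t)"
    using cov_phi[OF V t] by (simp add: frame_metric[OF t] legendre[OF t])
  then have "g (C t) (vel t) (cov phi_vel t) = g (C t) (cov vel t) (phi_vel t)"
    using phi_self_adjoint[OF p f(1) a] metric_sym[OF p a f(2)] by simp
  then have 3: "dt b t = 2 * g (C t) (cov vel t) (phi_vel t)"
    using dt_metric[OF V phi_vel_field t] by (simp add: b_def[abs_def])
  show ?thesis using tangent_comb[OF t a] b_nonzero[OF t] unfolding 1 2 3 by simp
qed

lemma cov_phi_vel:
  assumes t: "t \<in> I" shows "cov phi_vel t = comb t 0 (dt b t / (2 * b t)) 0"
proof -
  have "cov phi_vel t = \<phi> (C t) (cov vel t)"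
    using cov_phi[OF velocity_field_along t] by (simp add: frame_metric[OF t] legendre[OF t])
  then show ?thesis by (simp add: cov_velocity[OF t] phi_comb[OF t])
qed

lemma comb_field:
  assumes "smooth_along \<alpha>" "smooth_along \<beta>" "smooth_along \<gamma>"
  shows "field_along A I C (\<lambda>s. comb s (\<alpha> s) (\<beta> s) (\<gamma> s))"
  unfolding comb_def
  by (intro field_along_add field_along_scaleR assms velocity_field_along phi_vel_field reeb_field)

lemma cov_comb:
  assumes t: "t \<in> I" and \<alpha>: "(\<alpha> has_vector_derivative \<alpha>') (at t within I)"
    and \<beta>: "(\<beta> has_vector_derivative \<beta>') (at t within I)"
    and \<gamma>: "(\<gamma> has_vector_derivative \<gamma>') (at t within I)"
  shows "cov (\<lambda>s. comb s (\<alpha> s) (\<beta> s) (\<gamma> s)) t = comb t (\<alpha>' + \<alpha> t * dt b t / (2 * b t))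
    (\<beta>' + \<beta> t * dt b t / (2 * b t) - \<gamma> t) (\<gamma>' + \<alpha> t * b t)"
proof -
  note d = field_along_differentiable[OF velocity_field_along t] field_along_differentiable[OF phi_vel_field t]
    field_along_differentiable[OF reeb_field t]
  note d' = differentiable_along_scaleR[OF t \<alpha> d(1)] differentiable_along_scaleR[OF t \<beta> d(2)]
    differentiable_along_scaleR[OF t \<gamma> d(3)]
  have "cov (\<lambda>s. comb s (\<alpha> s) (\<beta> s) (\<gamma> s)) t =
    \<alpha>' *\<^sub>R vel t + \<alpha> t *\<^sub>R cov vel t + (\<beta>' *\<^sub>R phi_vel t + \<beta> t *\<^sub>R cov phi_vel t) + (\<gamma>' *\<^sub>R reeb t + \<gamma> t *\<^sub>R cov reeb t)"
    unfolding comb_def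
    by (simp only: cov_add[OF t differentiable_along_add[OF t d'(1,2)] d'(3)] cov_add[OF t d'(1,2)]
        cov_scaleR[OF t \<alpha> d(1)] cov_scaleR[OF t \<beta> d(2)] cov_scaleR[OF t \<gamma> d(3)])
  also have "\<dots> = \<alpha>' *\<^sub>R comb t 1 0 0 + \<alpha> t *\<^sub>R cov vel t + (\<beta>' *\<^sub>R comb t 0 1 0 + \<beta> t *\<^sub>R cov phi_vel t)
      + (\<gamma>' *\<^sub>R comb t 0 0 1 + \<gamma> t *\<^sub>R cov reeb t)"
    by (simp only: comb_units[symmetric])
  also have "\<dots> = comb t (\<alpha>' + \<alpha> t * dt b t / (2 * b t))
    (\<beta>' + \<beta> t * dt b t / (2 * b t) - \<gamma> t) (\<gamma>' + \<alpha> t * b t)"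
    unfolding cov_reeb[OF t] cov_velocity[OF t] cov_phi_vel[OF t] comb_scaleR comb_add
    by (rule arg_cong3[where f = "comb t"]) simp_all
  finally show ?thesis .
qed

section \<open>Frenet frames of the unit screens\<close>

text \<open>
  \<open>screen f \<delta>\<close> is \<open>\<delta> (\<xi> + f C')\<close>; for \<open>\<delta> = \<plusminus>1\<close> these are the unit fields orthogonal to \<open>C'\<close>.  The
  field \<open>transversal f\<close> and the functions below are the remaining vector and the coefficients of the
  Frenet frame that belongs to this screen.
\<close>

definition screen :: "(real \<Rightarrow> real) \<Rightarrow> real \<Rightarrow> real \<Rightarrow> 'a tvec" where
  "screen f \<delta> t = comb t (\<delta> * f t) 0 \<delta>"

definition transversal :: "(real \<Rightarrow> real) \<Rightarrow> real \<Rightarrow> 'a tvec" where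
  "transversal f t = comb t (- ((f t)\<^sup>2) / 2) (1 / b t) (- f t)"

definition h_screen :: "(real \<Rightarrow> real) \<Rightarrow> real \<Rightarrow> real" where
  "h_screen f t = dt b t / (2 * b t) - b t * f t"

definition k1_screen :: "real \<Rightarrow> real \<Rightarrow> real" where
  "k1_screen \<delta> t = \<delta> * b t"

definition k2_screen :: "(real \<Rightarrow> real) \<Rightarrow> real \<Rightarrow> real \<Rightarrow> real" where
  "k2_screen f \<delta> t = \<delta> * (b t * (f t)\<^sup>2 / 2 - dt f t - f t * dt b t / (2 * b t))"

context
  fixes f :: "real \<Rightarrow> real" and \<delta> :: real
  assumes f: "smooth_along f" and \<delta>: "\<delta> = 1 \<or> \<delta> = -1"
begin

lemma delta_square: "\<delta> * \<delta> = 1" using \<delta> by auto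

lemma frenet_frame_screen: "frenet_frame A g I C (transversal f) (screen f \<delta>)"
  unfolding frenet_frame_def
proof (intro conjI ballI)
  have "field_along A I C (\<lambda>t. comb t ((- 1 / 2) * (f t * f t)) (inverse (b t)) ((-1) * f t))"
    by (intro comb_field smooth_along_mult smooth_along_const smooth_along_inverse f smooth_along_b b_nonzero)
  then show "field_along A I C (transversal f)"
    by (simp add: transversal_def[abs_def] power2_eq_square inverse_eq_divide)
  show "field_along A I C (screen f \<delta>)"
    unfolding screen_def[abs_def]
    by (intro comb_field smooth_along_mult smooth_along_const f)
  fix t assume t: "t \<in> I"
  show "g (C t) (vel t) (transversal f t) = 1" "g (C t) (screen f \<delta> t) (screen f \<delta> t) = 1"
    "g (C t) (transversal f t) (transversal f t) = 0" "g (C t) (transversal f t) (screen f \<delta> t) = 0"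
    "g (C t) (vel t) (screen f \<delta> t) = 0"
    using b_nonzero[OF t] delta_square
    by (simp_all add: screen_def transversal_def comb_units(1)[of t] comb_metric[OF t] power2_eq_square field_simps)
qed

text \<open>
  The products of \<open>N\<close> with \<open>C'\<close>, with the screen and with itself fix its coefficients at \<open>\<phi> C'\<close>, at
  \<open>\<xi>\<close> and at \<open>C'\<close>, in this order.
\<close>

lemma frenet_frame_unique:
  assumes N: "frenet_frame A g I C N (screen f \<delta>)" and t: "t \<in> I"
  shows "N t = transversal f t"
proof -
  have "N t \<in> tangent_space A (C t)"
    using N t by (simp add: frenet_frame_def field_along_def)
  then obtain \<alpha> \<beta> \<gamma> where N_comb: "N t = comb t \<alpha> \<beta> \<gamma>" by (rule comb_spans[OF t])
  have "g (C t) (vel t) (N t) = 1" "g (C t) (N t) (N t) = 0" "g (C t) (N t) (screen f \<delta> t) = 0"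
    using N t by (simp_all add: frenet_frame_def)
  note eqs = this[unfolded N_comb screen_def comb_units(1)[of t] comb_metric[OF t]]
  have b_beta: "b t * \<beta> = 1" using eqs(1) by simp
  have eq2: "2 * \<alpha> * (b t * \<beta>) + \<gamma> * \<gamma> = 0" using eqs(2) by (simp add: algebra_simps)
  have eq3: "(b t * \<beta>) * (\<delta> * f t) + \<gamma> * \<delta> = 0" using eqs(3) by (simp add: algebra_simps)
  have "\<beta> = 1 / b t" using b_beta b_nonzero[OF t] by (simp add: field_simps)
  moreover have \<gamma>: "\<gamma> = - f t"
  proof -
    have "\<delta> * (f t + \<gamma>) = 0" using eq3 unfolding b_beta by (simp add: algebra_simps)
    then show ?thesis using \<delta> by auto
  qed
  moreover have "\<alpha> = - ((f t)\<^sup>2) / 2"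
    using eq2 unfolding b_beta \<gamma> by (simp add: power2_eq_square)
  ultimately show ?thesis by (simp add: N_comb transversal_def)
qed

text \<open>
  Each equation is compared coefficient by coefficient with the derivatives given by \<open>cov_comb\<close>;
  \<open>\<delta>\<^sup>2 = 1\<close> moves the factor \<open>\<delta>\<close> between the curvatures and the screen.
\<close>

lemma frenet_equations_screen:
  assumes N: "frenet_frame A g I C N (screen f \<delta>)"
  shows "frenet_equations A D I C N (screen f \<delta>) (h_screen f) (k1_screen \<delta>) (k2_screen f \<delta>)"
  unfolding frenet_equations_def
proof (intro ballI)
  fix t assume t: "t \<in> I"
  have b0: "b t \<noteq> 0" using b_nonzero[OF t] .
  have db: "(b has_real_derivative dt b t) (at t within I)" and df: "(f has_real_derivative dt f t) (at t within I)"
    using smooth_along_has_dt[OF smooth_along_b t] smooth_along_has_dt[OF f t]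
    by (simp_all add: has_real_derivative_iff_has_vector_derivative)
  have Nt: "N t = transversal f t" using frenet_frame_unique[OF N t] .
  have 1: "cov vel t = h_screen f t *\<^sub>R vel t + k1_screen \<delta> t *\<^sub>R screen f \<delta> t"
    unfolding cov_velocity[OF t] screen_def comb_units(1)[of t] comb_scaleR comb_add h_screen_def k1_screen_def
    by (rule arg_cong3[where f = "comb t"]) (use \<delta> in auto)
  have covN: "cov N t = comb t (- f t * dt f t + (- ((f t)\<^sup>2) / 2) * dt b t / (2 * b t))
      (- dt b t / (b t * b t) + 1 / b t * dt b t / (2 * b t) - (- f t)) (- dt f t + (- ((f t)\<^sup>2) / 2) * b t)"
  proof -
    have "cov N t = cov (transversal f) t"
      by (rule cov_cong[OF t]) (use frenet_frame_unique[OF N] in blast)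
    also have "\<dots> = comb t (- f t * dt f t + (- ((f t)\<^sup>2) / 2) * dt b t / (2 * b t))
      (- dt b t / (b t * b t) + 1 / b t * dt b t / (2 * b t) - (- f t)) (- dt f t + (- ((f t)\<^sup>2) / 2) * b t)"
      unfolding transversal_def[abs_def]
      by (rule cov_comb[OF t, unfolded has_real_derivative_iff_has_vector_derivative[symmetric]])
        (use b0 in \<open>auto intro!: derivative_eq_intros db df\<close>)
    finally show ?thesis .
  qed
  have 2: "cov N t = - h_screen f t *\<^sub>R N t + k2_screen f \<delta> t *\<^sub>R screen f \<delta> t"
    unfolding covN Nt transversal_def screen_def comb_scaleR comb_add h_screen_def k2_screen_def
    by (rule arg_cong3[where f = "comb t"]) (use b0 \<delta> in \<open>auto simp: field_simps power2_eq_square\<close>)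
  have covW: "cov (screen f \<delta>) t = comb t (\<delta> * dt f t + \<delta> * f t * dt b t / (2 * b t))
      (0 + 0 * dt b t / (2 * b t) - \<delta>) (0 + \<delta> * f t * b t)"
    unfolding screen_def[abs_def]
    by (rule cov_comb[OF t, unfolded has_real_derivative_iff_has_vector_derivative[symmetric]])
      (auto intro!: derivative_eq_intros df)
  have 3: "cov (screen f \<delta>) t = - k2_screen f \<delta> t *\<^sub>R vel t - k1_screen \<delta> t *\<^sub>R N t"
    unfolding covW Nt transversal_def comb_units(1)[of t] comb_scaleR comb_diff k1_screen_def k2_screen_def
    by (rule arg_cong3[where f = "comb t"]) (use b0 \<delta> in \<open>auto simp: field_simps power2_eq_square\<close>)
  show "cov vel t = h_screen f t *\<^sub>R vel t + k1_screen \<delta> t *\<^sub>R screen f \<delta> t \<and>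
    cov N t = - h_screen f t *\<^sub>R N t + k2_screen f \<delta> t *\<^sub>R screen f \<delta> t \<and>
    cov (screen f \<delta>) t = - k2_screen f \<delta> t *\<^sub>R vel t - k1_screen \<delta> t *\<^sub>R N t"
    using 1 2 3 by blast
qed

end

text \<open>
  The functions \<open>h\<close> and \<open>k2\<close> are products of covariant derivatives with frame vectors, so they are
  determined by the frame.
\<close>

lemma frenet_equations_unique:
  assumes F: "frenet_frame A g I C N W" and E: "frenet_equations A D I C N W h k1 k2" and t: "t \<in> I"
  shows "h t = g (C t) (cov vel t) (N t)" "k2 t = g (C t) (cov N t) (W t)"
proof -
  note p = curve_in_topspace[OF t]
  have N: "N t \<in> tangent_space A (C t)" and W: "W t \<in> tangent_space A (C t)"
    using F t by (simp_all add: frenet_frame_def field_along_def)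
  have F: "g (C t) (vel t) (N t) = 1" "g (C t) (W t) (W t) = 1" "g (C t) (N t) (N t) = 0" "g (C t) (N t) (W t) = 0"
    "g (C t) (W t) (N t) = 0"
    using F t metric_sym[OF p N W] by (simp_all add: frenet_frame_def)
  have E: "cov vel t = h t *\<^sub>R vel t + k1 t *\<^sub>R W t" "cov N t = - h t *\<^sub>R N t + k2 t *\<^sub>R W t"
    using E t unfolding frenet_equations_def by blast+
  show "h t = g (C t) (cov vel t) (N t)" "k2 t = g (C t) (cov N t) (W t)"
    unfolding E metric_linear[OF p frame_tangent(1)[OF t] W N] metric_linear[OF p N W W] by (simp_all add: F)
qed

lemma frenet_curvatures_unique:
  assumes "frenet_frame A g I C N W" "frenet_equations A D I C N W h k1 k2"
    "frenet_equations A D I C N W h' k1' k2'" "t \<in> I"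
  shows "h t = h' t" "k2 t = k2' t"
  using frenet_equations_unique[OF assms(1,2,4)] frenet_equations_unique[OF assms(1,3,4)] by simp_all

end

theorem corollary4p3:
  fixes T :: "'m topology" and A :: "'m chart set"
    and \<phi> :: "'m \<Rightarrow> 'm tvec \<Rightarrow> 'm tvec" and \<xi> :: "'m \<Rightarrow> 'm tvec" and \<eta> :: "'m \<Rightarrow> 'm tvec \<Rightarrow> real"
    and g :: "'m \<Rightarrow> 'm tvec \<Rightarrow> 'm tvec \<Rightarrow> real" and D :: "'m connection"
    and I :: "real set" and C :: "real \<Rightarrow> 'm" and \<epsilon> \<epsilon>1 :: real
    and C' W W1 :: "real \<Rightarrow> 'm tvec" and b b' b'' :: "real \<Rightarrow> real"
  assumes "almost_contact_B_metric_3_manifold T A \<phi> \<xi> \<eta> g"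
    and "levi_civita_connection T A g D"
    and "sasaki_like T A \<phi> \<xi> \<eta> g D"
    and "null_curve T A g I C" and "legendre_curve T A \<eta> I C"
    and "\<epsilon> = 1 \<or> \<epsilon> = -1" and "\<epsilon>1 = 1 \<or> \<epsilon>1 = -1"
    and C'_def: "C' = velocity A I C"
    and b_def: "b = (\<lambda>t. g (C t) (C' t) (\<phi> (C t) (C' t)))"
    and b'_def: "b' = (\<lambda>t. vector_derivative b (at t within I))"
    and b''_def: "b'' = (\<lambda>t. vector_derivative b' (at t within I))"
    and W_def: "W = (\<lambda>t. \<epsilon> *\<^sub>R \<xi> (C t))"
    and W1_def: "W1 = (\<lambda>t. \<epsilon>1 *\<^sub>R (\<epsilon> *\<^sub>R \<xi> (C t) + (\<epsilon> * (b' t / (2 * (b t)\<^sup>2))) *\<^sub>R C' t))"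
  shows
    "(\<exists>N. frenet_frame A g I C N W) \<and>
     (\<forall>N. frenet_frame A g I C N W \<longrightarrow>
        (\<forall>t\<in>I. N t = (1 / b t) *\<^sub>R \<phi> (C t) (C' t)) \<and>
        (\<exists>h k1 k2. frenet_equations A D I C N W h k1 k2) \<and>
        (\<forall>h k1 k2. frenet_equations A D I C N W h k1 k2 \<longrightarrow>
           (\<forall>t\<in>I. h t = b' t / (2 * b t) \<and> k2 t = 0))) \<and>
     (\<exists>N1. frenet_frame A g I C N1 W1) \<and>
     (\<forall>N1. frenet_frame A g I C N1 W1 \<longrightarrow>
        (\<forall>t\<in>I. N1 t = - (b' t / (2 * (b t)\<^sup>2)) *\<^sub>R \<xi> (C t)
                     - ((b' t)\<^sup>2 / (8 * b t ^ 4)) *\<^sub>R C' t + (1 / b t) *\<^sub>R \<phi> (C t) (C' t)) \<and>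
        distinguished_parameter A D I C N1 W1 \<and>
        (\<forall>h1 k1 k2. frenet_equations A D I C N1 W1 h1 k1 k2 \<longrightarrow>
           (\<forall>t\<in>I. k2 t = - \<epsilon> * \<epsilon>1 * ((4 * b t * b'' t - 7 * (b' t)\<^sup>2) / (8 * b t ^ 3)))))"
proof -
  interpret K: null_legendre_curve T A \<phi> \<xi> \<eta> g D I C
    by unfold_locales (use assms(1-5) in \<open>auto simp: null_curve_def legendre_curve_def\<close>)
  have b: "b = K.b" by (simp add: b_def C'_def K.b_def[abs_def])
  have b0: "b t \<noteq> 0" if "t \<in> I" for t using K.b_nonzero[OF that] by (simp add: b)
  have smooth_b: "K.smooth_along b" and smooth_b': "K.smooth_along b'"
    using K.smooth_along_b K.smooth_along_dt[of b] by (simp_all add: b b'_def)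
  \<comment> \<open>The two screens are \<open>\<epsilon> (\<xi> + z C')\<close> and \<open>\<delta> (\<xi> + f C')\<close>.\<close>
  define z :: "real \<Rightarrow> real" where "z = (\<lambda>t. 0)"
  define f where "f = (\<lambda>t. b' t / (2 * (b t)\<^sup>2))"
  define \<delta> where "\<delta> = \<epsilon>1 * \<epsilon>"
  have \<delta>: "\<delta> = 1 \<or> \<delta> = -1" using assms(6,7) by (auto simp: \<delta>_def)
  have z: "K.smooth_along z" unfolding z_def by (rule K.smooth_along_const)
  have f: "K.smooth_along f"
  proof -
    \<comment> \<open>The quotient is written as a product to match the closure rules for smooth functions.\<close>
    have "K.smooth_along (\<lambda>t. (1/2) * (b' t * (inverse (b t) * inverse (b t))))"
      by (intro K.smooth_along_mult K.smooth_along_const K.smooth_along_inverse smooth_b smooth_b' b0)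
    also have "(\<lambda>t. (1/2) * (b' t * (inverse (b t) * inverse (b t)))) = f"
      by (rule ext) (simp only: f_def power2_eq_square divide_inverse inverse_mult_distrib mult_1_left mult_ac)
    finally show ?thesis .
  qed
  have W: "W = K.screen z \<epsilon>"
    by (rule ext) (simp add: W_def K.screen_def z_def K.comb_def)
  have W1: "W1 = K.screen f \<delta>"
  proof
    fix t
    have rearrange: "\<epsilon>1 *\<^sub>R (\<epsilon> *\<^sub>R u + (\<epsilon> * x) *\<^sub>R v) = (\<delta> * x) *\<^sub>R v + 0 *\<^sub>R w + \<delta> *\<^sub>R u" for u v w :: "'m tvec" and x
      unfolding \<delta>_def scaleR_add_right scaleR_scaleR scaleR_zero_left add_0_right mult.assoc by (rule add.commute)
    show "W1 t = K.screen f \<delta> t"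
      unfolding W1_def K.screen_def K.comb_def C'_def f_def by (rule rearrange)
  qed
  have frame: "frenet_frame A g I C (K.transversal z) W" "frenet_frame A g I C (K.transversal f) W1"
    unfolding W W1 by (rule K.frenet_frame_screen[OF z assms(6)] K.frenet_frame_screen[OF f \<delta>])+
  have N: "N t = (1 / b t) *\<^sub>R \<phi> (C t) (C' t)" if "frenet_frame A g I C N W" "t \<in> I" for N t
    unfolding K.frenet_frame_unique[OF z assms(6) that(1)[unfolded W] that(2)]
    by (simp add: K.transversal_def K.comb_def z_def b C'_def)
  have N1: "N1 t = - (b' t / (2 * (b t)\<^sup>2)) *\<^sub>R \<xi> (C t) - ((b' t)\<^sup>2 / (8 * b t ^ 4)) *\<^sub>R C' t
      + (1 / b t) *\<^sub>R \<phi> (C t) (C' t)" if "frenet_frame A g I C N1 W1" "t \<in> I" for N1 t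
  proof -
    have "(f t)\<^sup>2 / 2 = (b' t)\<^sup>2 / (8 * b t ^ 4)"
      by (simp add: f_def power_divide power_mult_distrib flip: power_mult)
    then have "N1 t = - ((b' t)\<^sup>2 / (8 * b t ^ 4)) *\<^sub>R C' t + (1 / b t) *\<^sub>R \<phi> (C t) (C' t)
        + - (b' t / (2 * (b t)\<^sup>2)) *\<^sub>R \<xi> (C t)"
      using K.frenet_frame_unique[OF f \<delta> that(1)[unfolded W1] that(2)]
      by (simp only: K.transversal_def K.comb_def b C'_def minus_divide_left[symmetric]) (simp only: f_def b)
    moreover have "- y *\<^sub>R v + w + - x *\<^sub>R u = - x *\<^sub>R u - y *\<^sub>R v + w"
      for u v w :: "'m tvec" and x y :: real
      by (simp only: scaleR_minus_left diff_conv_add_uminus add_ac)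
    ultimately show ?thesis by (rule trans)
  qed
  have E: "frenet_equations A D I C N W (K.h_screen z) (K.k1_screen \<epsilon>) (K.k2_screen z \<epsilon>)"
    if "frenet_frame A g I C N W" for N
    using K.frenet_equations_screen[OF z assms(6)] that unfolding W by blast
  have E1: "frenet_equations A D I C N1 W1 (K.h_screen f) (K.k1_screen \<delta>) (K.k2_screen f \<delta>)"
    if "frenet_frame A g I C N1 W1" for N1
    using K.frenet_equations_screen[OF f \<delta>] that unfolding W1 by blast
  have h: "K.h_screen z t = b' t / (2 * b t)" "K.k2_screen z \<epsilon> t = 0" if "t \<in> I" for t
    using K.dt_eq[OF has_vector_derivative_const that, of "0 :: real"]
    by (simp_all add: K.h_screen_def K.k2_screen_def z_def b b'_def)
  have h1: "K.h_screen f t = 0" if "t \<in> I" for t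
    using b0[OF that] unfolding K.h_screen_def f_def b[symmetric] b'_def[THEN fun_cong, symmetric]
    by (simp add: power2_eq_square)
  have k2: "K.k2_screen f \<delta> t = - \<epsilon> * \<epsilon>1 * ((4 * b t * b'' t - 7 * (b' t)\<^sup>2) / (8 * b t ^ 3))" if t: "t \<in> I" for t
  proof -
    have "(b has_real_derivative b' t) (at t within I)" "(b' has_real_derivative b'' t) (at t within I)"
      using K.smooth_along_has_dt[OF smooth_b t] K.smooth_along_has_dt[OF smooth_b' t]
      by (simp_all add: b'_def b''_def has_real_derivative_iff_has_vector_derivative)
    then have "(f has_real_derivative (b'' t / (2 * (b t)\<^sup>2) - (b' t)\<^sup>2 / b t ^ 3)) (at t within I)"
      unfolding f_def using b0[OF t]
      by (auto intro!: derivative_eq_intros simp: field_simps power2_eq_square power3_eq_cube)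
    then have df: "vector_derivative f (at t within I) = b'' t / (2 * (b t)\<^sup>2) - (b' t)\<^sup>2 / b t ^ 3"
      using K.dt_eq[OF _ t] by (simp add: has_real_derivative_iff_has_vector_derivative)
    show ?thesis
      unfolding K.k2_screen_def df b[symmetric] b'_def[THEN fun_cong, symmetric]
      unfolding f_def \<delta>_def
      using b0[OF t] by (simp add: field_simps power2_eq_square power3_eq_cube)
  qed
  show ?thesis
  proof (intro conjI allI impI ballI)
    show "\<exists>N. frenet_frame A g I C N W" "\<exists>N1. frenet_frame A g I C N1 W1"
      using frame by blast+
    fix N assume F: "frenet_frame A g I C N W"
    show "\<exists>h k1 k2. frenet_equations A D I C N W h k1 k2" using E[OF F] by blast
    fix t assume t: "t \<in> I"
    show "N t = (1 / b t) *\<^sub>R \<phi> (C t) (C' t)" using N[OF F t] .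
    fix h k1 k2 assume "frenet_equations A D I C N W h k1 k2"
    from K.frenet_curvatures_unique[OF F this E[OF F] t] show "h t = b' t / (2 * b t)" "k2 t = 0"
      by (simp_all only: h[OF t])
  next
    fix N1 assume F: "frenet_frame A g I C N1 W1"
    show "distinguished_parameter A D I C N1 W1"
      unfolding distinguished_parameter_def using E1[OF F] h1 by blast
    fix t assume t: "t \<in> I"
    show "N1 t = - (b' t / (2 * (b t)\<^sup>2)) *\<^sub>R \<xi> (C t) - ((b' t)\<^sup>2 / (8 * b t ^ 4)) *\<^sub>R C' t
      + (1 / b t) *\<^sub>R \<phi> (C t) (C' t)" using N1[OF F t] .
    fix h1 k1 k2 assume "frenet_equations A D I C N1 W1 h1 k1 k2"
    from K.frenet_curvatures_unique(2)[OF F this E1[OF F] t]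
    show "k2 t = - \<epsilon> * \<epsilon>1 * ((4 * b t * b'' t - 7 * (b' t)\<^sup>2) / (8 * b t ^ 3))"
      by (simp only: k2[OF t])
  qed
qed

end
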